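(* Let $G$ be a Garside group, the group of fractions of a Garside monoid $M$ with Garside element $\delta$. Let $x\in G$ and let $U\subseteq U_x$ be a nonempty subset. If $\{y^c: y\in U,\ c\in C_y\}\subseteq U$, then $U=U_x$.
   Context: **Garside monoids and groups.** Let $M$ be a (left and right) cancellative monoid. For $a,b\in M$ write $a\preceq b$ if $ac=b$ for some $c\in M$, and $a\succeq b$ if $a=cb$ for some $c\in M$. The (left) gcd $a\wedge b$ and (left) lcm $a\vee b$ are the greatest lower bound and least upper bound with respect to $\preceq$. An atom is an element $x\neq 1$ such that $x=ab$ with $a,b\in M$ implies $a=1$ or $b=1$. $M$ is atomic if it is generated by its atoms and for every $a\in M$ there is a bound $N_a$ such that $a$ is not a product of more than $N_a$ atoms. An element $\delta\in M$ is a Garside element if $\{x\in M: x\preceq\delta\}=\{x\in M:\delta\succeq x\}$ and this set is finite and generates $M$. $M$ is a Garside monoid if it is atomic, has a Garside element $\delta$, and gcd and lcm of any $a,b\in M$ exist (they are then unique). Its group of fractions $G$ is called a Garside group; $M$ embeds in $G$ and is identified with its image. The set of simple elements is $D=\{x\in M: x\preceq\delta\}$. Extend $\preceq$ to $G$ by: $a\preceq b$ iff $a^{-1}b\in M$; the notions $\wedge,\vee$ extend to $G$. Conjugation is $x^c=c^{-1}xc$, and $\tau(x)=x^\delta=\delta^{-1}x\delta$; $\tau$ preserves $M$ and $\preceq$. **Normal form.** For $x\in G$ let $\inf(x)$ be the maximal integer $k$ with $\delta^k\preceq x$, $\sup(x)$ the minimal integer $m$ with $x\preceq\delta^m$, and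 $\mathrm{len}(x)=\sup(x)-\inf(x)\ge 0$. With $k=\inf(x)$, $r=\mathrm{len}(x)$, there are unique $A_1,\dots,A_r\in D$ with $x=\delta^kA_1\cdots A_r$ and $A_i^{-1}\delta\wedge A_{i+1}=1$ for $i=1,\dots,r-1$; this is the normal form of $x$. **Super summit set.** $S_x$ is the set of conjugates $y$ of $x$ in $G$ for which $\inf(y)$ is maximal and $\sup(y)$ is minimal among all conjugates of $x$ (this set is finite and nonempty). **Cycling.** If $x$ has normal form $\delta^kA_1\cdots A_r$, put $\mathbf{c}(x)=x$ if $r=0$ and $\mathbf{c}(x)=x^{\tau^{-k}(A_1)}$ otherwise. Cycling maps $S_x$ to itself. **Ultra summit set.** $U_x=\{y\in S_x:\mathbf{c}^k(y)=y\text{ for some }k>0\}$. **Minimal simple elements.** For $y\in U_x$ let $D_y=\{u\in D\setminus\{1\}: y^u\in U_x\}$ and let $C_y$ be the set of $\preceq$-minimal elements of $D_y$. *)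

theory Defs
  imports "HOL-Algebra.Divisibility"
begin

section \<open>Garside monoids\<close>

text \<open>
  In a possibly noncommutative monoid \<open>M\<close>, the library relation \<open>a divides\<^bsub>M\<^esub> b\<close> says
  \<open>b = a \<otimes> c\<close> for some \<open>c\<close> in \<open>M\<close>, that is, \<open>a\<close> is a left divisor of \<open>b\<close>. Consequently
  \<open>gcdof\<close> and \<open>lcmof\<close> are the left gcd and the left lcm.
\<close>

definition right_divides :: "('a, 'b) monoid_scheme \<Rightarrow> 'a \<Rightarrow> 'a \<Rightarrow> bool"
  where "right_divides M b a \<longleftrightarrow> (\<exists>c\<in>carrier M. a = c \<otimes>\<^bsub>M\<^esub> b)"

definition list_prod :: "('a, 'b) monoid_scheme \<Rightarrow> 'a list \<Rightarrow> 'a"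
  where "list_prod M as = foldr (\<otimes>\<^bsub>M\<^esub>) as \<one>\<^bsub>M\<^esub>"

definition generates_monoid :: "('a, 'b) monoid_scheme \<Rightarrow> 'a set \<Rightarrow> bool"
  where "generates_monoid M S \<longleftrightarrow>
    S \<subseteq> carrier M \<and> (\<forall>a\<in>carrier M. \<exists>as. set as \<subseteq> S \<and> list_prod M as = a)"

definition atoms :: "('a, 'b) monoid_scheme \<Rightarrow> 'a set"
  where "atoms M = {x \<in> carrier M. x \<noteq> \<one>\<^bsub>M\<^esub> \<and>
    (\<forall>a\<in>carrier M. \<forall>b\<in>carrier M. x = a \<otimes>\<^bsub>M\<^esub> b \<longrightarrow> a = \<one>\<^bsub>M\<^esub> \<or> b = \<one>\<^bsub>M\<^esub>)}"

definition atomic_monoid :: "('a, 'b) monoid_scheme \<Rightarrow> bool"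
  where "atomic_monoid M \<longleftrightarrow> generates_monoid M (atoms M) \<and>
    (\<forall>a\<in>carrier M. \<exists>N::nat. \<forall>as. set as \<subseteq> atoms M \<and> list_prod M as = a \<longrightarrow> length as \<le> N)"

definition garside_element :: "('a, 'b) monoid_scheme \<Rightarrow> 'a \<Rightarrow> bool"
  where "garside_element M \<delta> \<longleftrightarrow> \<delta> \<in> carrier M \<and>
    {x \<in> carrier M. x divides\<^bsub>M\<^esub> \<delta>} = {x \<in> carrier M. right_divides M x \<delta>} \<and>
    finite {x \<in> carrier M. x divides\<^bsub>M\<^esub> \<delta>} \<and>
    generates_monoid M {x \<in> carrier M. x divides\<^bsub>M\<^esub> \<delta>}"

locale garside_monoid = monoid_cancel M for M (structure) +
  fixes \<delta>
  assumes atomic: "atomic_monoid M"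
    and garside_element: "garside_element M \<delta>"
    and gcd_exists: "\<lbrakk>a \<in> carrier M; b \<in> carrier M\<rbrakk> \<Longrightarrow> \<exists>d\<in>carrier M. d gcdof a b"
    and lcm_exists: "\<lbrakk>a \<in> carrier M; b \<in> carrier M\<rbrakk> \<Longrightarrow> \<exists>m\<in>carrier M. m lcmof a b"


section \<open>Garside groups\<close>

text \<open>
  The Garside monoid is identified with its image \<open>M\<close> in its group of fractions \<open>G\<close>, so its
  operation and unit are those of \<open>G\<close>. Every element of \<open>G\<close> being a fraction characterises \<open>G\<close>
  as the group of fractions of \<open>M\<close>, up to a unique isomorphism fixing \<open>M\<close>.
\<close>

locale garside_group = group G + garside_monoid "G\<lparr>carrier := M\<rparr>" \<delta>
  for G (structure) and M :: "'a set" and \<delta> :: 'a +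
  assumes monoid_subset: "M \<subseteq> carrier G"
    and fractions: "g \<in> carrier G \<Longrightarrow> \<exists>a\<in>M. \<exists>b\<in>M. g = a \<otimes> inv b"

definition left_order :: "('a, 'b) monoid_scheme \<Rightarrow> 'a set \<Rightarrow> 'a gorder"
  where "left_order G M =
    \<lparr>carrier = carrier G, eq = (=), le = (\<lambda>a b. inv\<^bsub>G\<^esub> a \<otimes>\<^bsub>G\<^esub> b \<in> M)\<rparr>"

definition simple_elements :: "('a, 'b) monoid_scheme \<Rightarrow> 'a set \<Rightarrow> 'a \<Rightarrow> 'a set"
  where "simple_elements G M \<delta> = {x \<in> M. x \<sqsubseteq>\<^bsub>left_order G M\<^esub> \<delta>}"

definition conj_by :: "('a, 'b) monoid_scheme \<Rightarrow> 'a \<Rightarrow> 'a \<Rightarrow> 'a"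
  where "conj_by G x c = inv\<^bsub>G\<^esub> c \<otimes>\<^bsub>G\<^esub> x \<otimes>\<^bsub>G\<^esub> c"

definition conjugates :: "('a, 'b) monoid_scheme \<Rightarrow> 'a \<Rightarrow> 'a set"
  where "conjugates G x = {conj_by G x c | c. c \<in> carrier G}"

text \<open>The \<open>j\<close>-th iterate, \<open>j\<close> possibly negative, of conjugation by \<open>\<delta>\<close>.\<close>

definition tau_pow :: "('a, 'b) monoid_scheme \<Rightarrow> 'a \<Rightarrow> int \<Rightarrow> 'a \<Rightarrow> 'a"
  where "tau_pow G \<delta> j x = conj_by G x (\<delta> [^]\<^bsub>G\<^esub> j)"

text \<open>
  The extrema below exist unless \<open>\<delta> = \<one>\<close>, which happens only for the trivial group; there
  \<open>\<delta>_inf\<close> and \<open>\<delta>_sup\<close> are unspecified integers.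
\<close>

definition \<delta>_inf :: "('a, 'b) monoid_scheme \<Rightarrow> 'a set \<Rightarrow> 'a \<Rightarrow> 'a \<Rightarrow> int"
  where "\<delta>_inf G M \<delta> x = (GREATEST k. \<delta> [^]\<^bsub>G\<^esub> k \<sqsubseteq>\<^bsub>left_order G M\<^esub> x)"

definition \<delta>_sup :: "('a, 'b) monoid_scheme \<Rightarrow> 'a set \<Rightarrow> 'a \<Rightarrow> 'a \<Rightarrow> int"
  where "\<delta>_sup G M \<delta> x = (LEAST m. x \<sqsubseteq>\<^bsub>left_order G M\<^esub> \<delta> [^]\<^bsub>G\<^esub> m)"

definition canonical_length :: "('a, 'b) monoid_scheme \<Rightarrow> 'a set \<Rightarrow> 'a \<Rightarrow> 'a \<Rightarrow> int"
  where "canonical_length G M \<delta> x = \<delta>_sup G M \<delta> x - \<delta>_inf G M \<delta> x"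

definition is_normal_form :: "('a, 'b) monoid_scheme \<Rightarrow> 'a set \<Rightarrow> 'a \<Rightarrow> 'a \<Rightarrow> 'a list \<Rightarrow> bool"
  where "is_normal_form G M \<delta> x as \<longleftrightarrow>
    int (length as) = canonical_length G M \<delta> x \<and>
    set as \<subseteq> simple_elements G M \<delta> \<and>
    x = \<delta> [^]\<^bsub>G\<^esub> \<delta>_inf G M \<delta> x \<otimes>\<^bsub>G\<^esub> list_prod G as \<and>
    (\<forall>i. Suc i < length as \<longrightarrow>
      (inv\<^bsub>G\<^esub> (as ! i) \<otimes>\<^bsub>G\<^esub> \<delta>) \<sqinter>\<^bsub>left_order G M\<^esub> (as ! Suc i) = \<one>\<^bsub>G\<^esub>)"

definition normal_form :: "('a, 'b) monoid_scheme \<Rightarrow> 'a set \<Rightarrow> 'a \<Rightarrow> 'a \<Rightarrow> 'a list"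
  where "normal_form G M \<delta> x = (THE as. is_normal_form G M \<delta> x as)"

definition super_summit_set :: "('a, 'b) monoid_scheme \<Rightarrow> 'a set \<Rightarrow> 'a \<Rightarrow> 'a \<Rightarrow> 'a set"
  where "super_summit_set G M \<delta> x = {y \<in> conjugates G x.
    \<forall>z\<in>conjugates G x. \<delta>_inf G M \<delta> z \<le> \<delta>_inf G M \<delta> y \<and> \<delta>_sup G M \<delta> y \<le> \<delta>_sup G M \<delta> z}"

definition cycling :: "('a, 'b) monoid_scheme \<Rightarrow> 'a set \<Rightarrow> 'a \<Rightarrow> 'a \<Rightarrow> 'a"
  where "cycling G M \<delta> x =
    (if canonical_length G M \<delta> x = 0 then x
     else conj_by G x (tau_pow G \<delta> (- \<delta>_inf G M \<delta> x) (hd (normal_form G M \<delta> x))))"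

definition ultra_summit_set :: "('a, 'b) monoid_scheme \<Rightarrow> 'a set \<Rightarrow> 'a \<Rightarrow> 'a \<Rightarrow> 'a set"
  where "ultra_summit_set G M \<delta> x =
    {y \<in> super_summit_set G M \<delta> x. \<exists>k>0. (cycling G M \<delta> ^^ k) y = y}"

text \<open>
  The sets \<open>D\<^sub>y\<close> and \<open>C\<^sub>y\<close> for \<open>y\<close> in the ultra summit set of \<open>x\<close>.
\<close>

definition uss_conjugators ::
  "('a, 'b) monoid_scheme \<Rightarrow> 'a set \<Rightarrow> 'a \<Rightarrow> 'a \<Rightarrow> 'a \<Rightarrow> 'a set"
  where "uss_conjugators G M \<delta> x y =
    {u \<in> simple_elements G M \<delta> - {\<one>\<^bsub>G\<^esub>}. conj_by G y u \<in> ultra_summit_set G M \<delta> x}"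

definition minimal_uss_conjugators ::
  "('a, 'b) monoid_scheme \<Rightarrow> 'a set \<Rightarrow> 'a \<Rightarrow> 'a \<Rightarrow> 'a \<Rightarrow> 'a set"
  where "minimal_uss_conjugators G M \<delta> x y =
    {c \<in> uss_conjugators G M \<delta> x y.
      \<forall>u\<in>uss_conjugators G M \<delta> x y. u \<sqsubseteq>\<^bsub>left_order G M\<^esub> c \<longrightarrow> u = c}"

end

theory Submission
  imports Defs
begin

text \<open>
  Write \<open>k = inf y\<close> and \<open>a(y) = y \<delta>\<^sup>-\<^sup>k \<and> \<delta>\<close>; cycling is conjugation of \<open>y\<close> by \<open>a(y)\<close>. The transport
  of \<open>s\<close>, namely \<open>a(y)\<^sup>-\<^sup>1 (y s \<delta>\<^sup>-\<^sup>k \<and> s \<delta>)\<close>, is compatible with gcds and fixes the powers of \<open>\<delta>\<close>. It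
  conjugates the cycling of \<open>y\<close> to that of \<open>y\<^sup>s\<close> if \<open>y\<close> and \<open>y\<^sup>s\<close> are both in the super summit set.
  If both are even in the ultra summit set, then cycling together with transport is injective on
  a finite set of such pairs \<open>(y, s)\<close>, so \<open>s\<close> is recovered after finitely many steps. As gcds are
  transported to gcds, \<open>y\<^sup>s\<close> and \<open>y\<^sup>t\<close> in the ultra summit set force \<open>y\<close> conjugated by \<open>s \<and> t\<close> to be there.

  Any two elements of the ultra summit set are conjugate by a positive element \<open>c\<close>, because a power
  of \<open>\<delta>\<close> commutes with the first one. Applied to \<open>c\<close> and \<open>\<delta>\<close>, the gcd property splits off a simple,
  hence also a minimal, conjugator from \<open>c\<close>, and the number of divisors of \<open>c\<close> decreases.
\<close>

section \<open>Groups ordered by a positive cone\<close>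

lemma (in group) inv_mult_cancel:
  assumes "a \<in> carrier G" "b \<in> carrier G"
  shows "inv a \<otimes> (a \<otimes> b) = b" and "a \<otimes> (inv a \<otimes> b) = b"
  using assms by (simp_all flip: m_assoc)

text \<open>The argument runs inside \<open>G\<close>, with \<open>M\<close> entering through these
  properties. The two conjugation assumptions make conjugation by \<delta> a bijection of
  \<open>M\<close>; \<open>delta_not_one\<close> makes infimum and supremum exist.\<close>

locale garside_cone = group G for G (structure) +
  fixes M :: "'a set" and \<delta> :: 'a
  assumes cone_subset: "M \<subseteq> carrier G"
    and one_cone: "\<one> \<in> M"
    and mult_cone: "\<lbrakk>a \<in> M; b \<in> M\<rbrakk> \<Longrightarrow> a \<otimes> b \<in> M"
    and cone_pointed: "\<lbrakk>a \<in> M; inv a \<in> M\<rbrakk> \<Longrightarrow> a = \<one>"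
    and delta_cone: "\<delta> \<in> M"
    and delta_not_one: "\<delta> \<noteq> \<one>"
    and conj_delta_cone: "a \<in> M \<Longrightarrow> inv \<delta> \<otimes> a \<otimes> \<delta> \<in> M"
    and conj_inv_delta_cone: "a \<in> M \<Longrightarrow> \<delta> \<otimes> a \<otimes> inv \<delta> \<in> M"
    and finite_simples: "finite {s \<in> M. inv s \<otimes> \<delta> \<in> M}"
    and delta_pow_mult_cone: "g \<in> carrier G \<Longrightarrow> \<exists>n::nat. \<delta> [^] n \<otimes> g \<in> M"
    and cone_gcd: "\<lbrakk>a \<in> M; b \<in> M\<rbrakk> \<Longrightarrow> \<exists>d\<in>M. inv d \<otimes> a \<in> M \<and> inv d \<otimes> b \<in> M \<and>
      (\<forall>e\<in>M. inv e \<otimes> a \<in> M \<and> inv e \<otimes> b \<in> M \<longrightarrow> inv e \<otimes> d \<in> M)"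
begin

abbreviation cone_le (infix "\<preceq>" 50)
  where "a \<preceq> b \<equiv> a \<sqsubseteq>\<^bsub>left_order G M\<^esub> b"

abbreviation cone_meet (infixl "\<curlywedge>" 65)
  where "a \<curlywedge> b \<equiv> a \<sqinter>\<^bsub>left_order G M\<^esub> b"

lemma le_iff: "a \<preceq> b \<longleftrightarrow> inv a \<otimes> b \<in> M"
  by (simp add: left_order_def)

lemma carrier_left_order [simp]: "carrier (left_order G M) = carrier G"
  by (simp add: left_order_def)

lemma eq_left_order [simp]: "eq (left_order G M) = (=)"
  by (simp add: left_order_def)

lemma cone_carrier [simp]: "a \<in> M \<Longrightarrow> a \<in> carrier G"
  using cone_subset by blast

lemma delta_carrier [simp]: "\<delta> \<in> carrier G"
  by (simp add: delta_cone)

lemma le_translate [simp]: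
  assumes "a \<in> carrier G" "b \<in> carrier G" "c \<in> carrier G"
  shows "c \<otimes> a \<preceq> c \<otimes> b \<longleftrightarrow> a \<preceq> b"
  using assms by (simp add: le_iff m_assoc inv_mult_group inv_mult_cancel)

lemma le_trans:
  assumes "a \<preceq> b" "b \<preceq> c" "a \<in> carrier G" "b \<in> carrier G" "c \<in> carrier G"
  shows "a \<preceq> c"
  using mult_cone[of "inv a \<otimes> b" "inv b \<otimes> c"] assms
  by (simp add: le_iff m_assoc inv_mult_cancel)

lemma le_antisym:
  assumes "a \<preceq> b" "b \<preceq> a" "a \<in> carrier G" "b \<in> carrier G"
  shows "a = b"
proof -
  have "inv a \<otimes> b = \<one>"
    using assms by (intro cone_pointed) (simp_all add: le_iff inv_mult_group)
  then show ?thesis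
    using assms by (metis inv_mult_cancel(2) r_one)
qed

lemma le_mult:
  assumes "a \<in> carrier G" "m \<in> M"
  shows "a \<preceq> a \<otimes> m"
  using assms by (simp add: le_iff inv_mult_cancel)

lemma one_le_iff: "a \<in> carrier G \<Longrightarrow> \<one> \<preceq> a \<longleftrightarrow> a \<in> M"
  by (simp add: le_iff)

lemma delta_pow_cone: "\<delta> [^] (n::nat) \<in> M"
  by (induction n) (simp_all add: one_cone mult_cone delta_cone)

lemma conj_delta_pow_cone:
  assumes "a \<in> M"
  shows "inv (\<delta> [^] (k::int)) \<otimes> a \<otimes> \<delta> [^] k \<in> M"
proof -
  have pos: "inv (\<delta> [^] n) \<otimes> a \<otimes> \<delta> [^] n \<in> M" for n :: nat
  proof (induction n)
    case (Suc n)
    then show ?case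
      using assms conj_delta_cone[OF Suc]
      by (simp add: m_assoc inv_mult_group)
  qed (use assms in simp)
  have neg: "\<delta> [^] n \<otimes> a \<otimes> inv (\<delta> [^] n) \<in> M" for n :: nat
  proof (induction n)
    case (Suc n)
    have "\<delta> [^] Suc n \<otimes> a \<otimes> inv (\<delta> [^] Suc n)
        = \<delta> \<otimes> (\<delta> [^] n \<otimes> a \<otimes> inv (\<delta> [^] n)) \<otimes> inv \<delta>"
      using assms unfolding nat_pow_Suc2[OF delta_carrier] by (simp add: m_assoc inv_mult_group)
    then show ?case
      using conj_inv_delta_cone[OF Suc] by simp
  qed (use assms in simp)
  show ?thesis
  proof (cases k)
    case (nonneg n)
    then show ?thesis using pos[of n] by (simp add: int_pow_int)
  next
    case negative: (neg n)
    then show ?thesis using neg[of "Suc n"]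
      by (simp only: int_pow_neg_int delta_carrier inv_inv nat_pow_closed)
  qed
qed

text \<open>A left-invariant order is in general not respected by right multiplication. Powers of
  \<delta> are an exception because conjugation by them preserves \<open>M\<close>.\<close>

lemma le_mult_delta_pow [simp]:
  assumes "a \<in> carrier G" "b \<in> carrier G"
  shows "a \<otimes> \<delta> [^] (k::int) \<preceq> b \<otimes> \<delta> [^] k \<longleftrightarrow> a \<preceq> b"
proof
  assume "a \<preceq> b"
  then show "a \<otimes> \<delta> [^] k \<preceq> b \<otimes> \<delta> [^] k"
    using conj_delta_pow_cone[of "inv a \<otimes> b" k] assms
    by (simp add: le_iff m_assoc inv_mult_group)
next
  assume "a \<otimes> \<delta> [^] k \<preceq> b \<otimes> \<delta> [^] k"
  then show "a \<preceq> b"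
    using conj_delta_pow_cone[of "inv (a \<otimes> \<delta> [^] k) \<otimes> (b \<otimes> \<delta> [^] k)" "- k"] assms
    by (simp add: le_iff m_assoc inv_mult_group int_pow_neg inv_mult_cancel)
qed

lemma le_mult_delta [simp]:
  assumes "a \<in> carrier G" "b \<in> carrier G"
  shows "a \<otimes> \<delta> \<preceq> b \<otimes> \<delta> \<longleftrightarrow> a \<preceq> b"
  using le_mult_delta_pow[OF assms, of 1] by (simp del: le_mult_delta_pow)

lemma le_delta_mult:
  assumes "m \<in> M"
  shows "\<delta> \<preceq> m \<otimes> \<delta>"
  using assms conj_delta_cone[OF assms] by (simp add: le_iff m_assoc)

section \<open>Bounds by powers of \<delta> and gcds of arbitrary group elements\<close>

lemma ex_delta_pow_le:
  assumes "g \<in> carrier G"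
  shows "\<exists>n::nat. \<delta> [^] (- int n) \<preceq> g"
  using delta_pow_mult_cone[OF assms] assms by (simp add: le_iff int_pow_neg_int)

lemma ex_le_delta_pow:
  assumes "g \<in> carrier G"
  shows "\<exists>n::nat. g \<preceq> \<delta> [^] n"
proof -
  obtain n :: nat where "\<delta> [^] n \<otimes> inv g \<in> M"
    using delta_pow_mult_cone assms by blast
  then have "inv g \<otimes> \<delta> [^] n \<in> M"
    using conj_delta_pow_cone[of "\<delta> [^] n \<otimes> inv g" "int n"] assms
    by (simp add: int_pow_int m_assoc inv_mult_cancel)
  then show ?thesis by (auto simp: le_iff)
qed

text \<open>\<open>cone_gcd\<close> covers positive elements only, and tests the gcd against
  positive divisors only. A power of \<delta> moves everything into \<open>M\<close>, and left
  translation carries the gcd back.\<close>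

lemma ex_greatest_lower:
  assumes a: "a \<in> carrier G" and b: "b \<in> carrier G"
  shows "\<exists>d\<in>carrier G. d \<preceq> a \<and> d \<preceq> b \<and> (\<forall>e\<in>carrier G. e \<preceq> a \<and> e \<preceq> b \<longrightarrow> e \<preceq> d)"
proof -
  have positive: "\<exists>d\<in>carrier G. d \<preceq> a \<and> d \<preceq> b \<and> (\<forall>e\<in>carrier G. e \<preceq> a \<and> e \<preceq> b \<longrightarrow> e \<preceq> d)"
    if ab: "a \<in> M" "b \<in> M" for a b
  proof -
    obtain d where d: "d \<in> M" "d \<preceq> a" "d \<preceq> b"
        "\<And>e. \<lbrakk>e \<in> M; e \<preceq> a; e \<preceq> b\<rbrakk> \<Longrightarrow> e \<preceq> d"
      using cone_gcd[OF ab] by (auto simp: le_iff)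
    have "e \<preceq> d" if e: "e \<in> carrier G" "e \<preceq> a" "e \<preceq> b" for e
    proof -
      obtain n :: nat where n: "\<delta> [^] n \<otimes> e \<in> M"
        using delta_pow_mult_cone e by blast
      let ?p = "\<delta> [^] n"
      have p: "?p \<in> M" by (rule delta_pow_cone)
      have "?p \<otimes> a \<in> M" "?p \<otimes> b \<in> M"
        using p ab by (simp_all add: mult_cone)
      from cone_gcd[OF this] obtain h where h: "h \<in> M" "h \<preceq> ?p \<otimes> a" "h \<preceq> ?p \<otimes> b"
          "\<And>e. \<lbrakk>e \<in> M; e \<preceq> ?p \<otimes> a; e \<preceq> ?p \<otimes> b\<rbrakk> \<Longrightarrow> e \<preceq> h"
        by (auto simp: le_iff)
      \<comment> \<open>\<open>?p\<close> is itself a positive common divisor of the shifted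
        elements, so \<open>h\<close> is \<open>?p\<close> times a positive element, to which the
        maximality of \<open>d\<close> applies.\<close>
      have "?p \<preceq> h" using h(4)[OF p] ab p by (simp add: le_mult)
      then have q: "inv ?p \<otimes> h \<in> M" by (simp add: le_iff)
      have h_eq: "h = ?p \<otimes> (inv ?p \<otimes> h)" using h(1) by (simp add: inv_mult_cancel)
      have "inv ?p \<otimes> h \<preceq> d"
      proof (rule d(4)[OF q])
        show "inv ?p \<otimes> h \<preceq> a"
          using h(2) h_eq q ab by (metis le_translate cone_carrier p)
        show "inv ?p \<otimes> h \<preceq> b"
          using h(3) h_eq q ab by (metis le_translate cone_carrier p)
      qed
      moreover have "?p \<otimes> e \<preceq> h"
        using h(4)[OF n] e ab p by simp
      then have "e \<preceq> inv ?p \<otimes> h"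
        using h_eq q e by (metis le_translate cone_carrier p)
      ultimately show ?thesis using le_trans q d(1) e(1) cone_carrier by blast
    qed
    then show ?thesis using d by auto
  qed
  obtain k l :: nat where kl: "\<delta> [^] k \<otimes> a \<in> M" "\<delta> [^] l \<otimes> b \<in> M"
    using delta_pow_mult_cone a b by blast
  let ?p = "\<delta> [^] (k + l)"
  have p_eq: "?p = \<delta> [^] k \<otimes> \<delta> [^] l" "?p = \<delta> [^] l \<otimes> \<delta> [^] k"
    by (simp_all add: nat_pow_mult add.commute)
  have "?p \<otimes> a \<in> M" "?p \<otimes> b \<in> M"
    using mult_cone[OF delta_pow_cone[of l] kl(1)] mult_cone[OF delta_pow_cone[of k] kl(2)]
    by (simp add: p_eq(2) m_assoc a, simp add: p_eq(1) m_assoc b)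
  from positive[OF this] obtain d where d: "d \<in> carrier G" "d \<preceq> ?p \<otimes> a" "d \<preceq> ?p \<otimes> b"
      "\<And>e. \<lbrakk>e \<in> carrier G; e \<preceq> ?p \<otimes> a; e \<preceq> ?p \<otimes> b\<rbrakk> \<Longrightarrow> e \<preceq> d"
    by metis
  have d_eq: "d = ?p \<otimes> (inv ?p \<otimes> d)" using d(1) by (simp add: inv_mult_cancel)
  show ?thesis
  proof (intro bexI conjI ballI impI)
    show "inv ?p \<otimes> d \<in> carrier G" using d(1) by simp
    show "inv ?p \<otimes> d \<preceq> a" "inv ?p \<otimes> d \<preceq> b"
      using d(1-3) d_eq a b by (metis le_translate inv_closed m_closed nat_pow_closed delta_carrier)+
    fix e assume e: "e \<in> carrier G" "e \<preceq> a \<and> e \<preceq> b"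
    then have "?p \<otimes> e \<preceq> d" by (intro d(4)) (simp_all add: a b)
    then show "e \<preceq> inv ?p \<otimes> d"
      using d(1) d_eq e(1) by (metis le_translate inv_closed m_closed nat_pow_closed delta_carrier)
  qed
qed

text \<open>Turns the meet operator occurring in \<open>is_normal_form\<close> into an actual gcd on
  \<open>G\<close>.\<close>

sublocale left_order: lower_semilattice "left_order G M"
proof
  show "a \<preceq> a" if "a \<in> carrier (left_order G M)" for a
    using that by (simp add: le_iff one_cone)
  show "a .=\<^bsub>left_order G M\<^esub> b"
    if "a \<preceq> b" "b \<preceq> a" "a \<in> carrier (left_order G M)" "b \<in> carrier (left_order G M)" for a b
    using that le_antisym by simp
  show "a \<preceq> c"
    if "a \<preceq> b" "b \<preceq> c" "a \<in> carrier (left_order G M)" "b \<in> carrier (left_order G M)"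
      "c \<in> carrier (left_order G M)" for a b c
    using that le_trans by (metis carrier_left_order)
  show "\<exists>s. greatest (left_order G M) s (Lower (left_order G M) {a, b})"
    if "a \<in> carrier (left_order G M)" "b \<in> carrier (left_order G M)" for a b
    using that ex_greatest_lower[of a b] by (auto simp: greatest_def Lower_def)
qed auto

lemma meet_closed [simp]: "\<lbrakk>a \<in> carrier G; b \<in> carrier G\<rbrakk> \<Longrightarrow> a \<curlywedge> b \<in> carrier G"
  using left_order.meet_closed by simp

lemma le_meet_iff [simp]:
  assumes "a \<in> carrier G" "b \<in> carrier G" "c \<in> carrier G"
  shows "c \<preceq> a \<curlywedge> b \<longleftrightarrow> c \<preceq> a \<and> c \<preceq> b"
proof -
  have "a \<curlywedge> b \<preceq> a" "a \<curlywedge> b \<preceq> b"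
    using assms by (simp_all add: left_order.meet_left left_order.meet_right)
  then show ?thesis
    using assms le_trans meet_closed left_order.meet_le by (metis carrier_left_order)
qed

lemma le_refl [simp]: "a \<in> carrier G \<Longrightarrow> a \<preceq> a"
  by (simp add: le_iff one_cone)

text \<open>Together with \<open>le_meet_iff\<close>, this reduces identities between gcds to
  propositional logic about lower bounds.\<close>

lemma eq_by_lower:
  assumes "a \<in> carrier G" "b \<in> carrier G" "\<And>c. c \<in> carrier G \<Longrightarrow> c \<preceq> a \<longleftrightarrow> c \<preceq> b"
  shows "a = b"
proof (rule le_antisym)
  show "a \<preceq> b" using assms(3)[OF assms(1)] le_refl[OF assms(1)] by (rule iffD1)
  show "b \<preceq> a" using assms(3)[OF assms(2)] le_refl[OF assms(2)] by (rule iffD2)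
qed (use assms in simp_all)

lemma meet_eqI:
  assumes "a \<in> carrier G" "b \<in> carrier G" "d \<in> carrier G"
    and "\<And>c. c \<in> carrier G \<Longrightarrow> c \<preceq> d \<longleftrightarrow> c \<preceq> a \<and> c \<preceq> b"
  shows "a \<curlywedge> b = d"
  using assms by (intro eq_by_lower) simp_all

lemma meet_lower1 [simp]: "\<lbrakk>a \<in> carrier G; b \<in> carrier G\<rbrakk> \<Longrightarrow> a \<curlywedge> b \<preceq> a"
  and meet_lower2 [simp]: "\<lbrakk>a \<in> carrier G; b \<in> carrier G\<rbrakk> \<Longrightarrow> a \<curlywedge> b \<preceq> b"
  by (simp_all add: left_order.meet_left left_order.meet_right)

lemma mult_meet:
  assumes "a \<in> carrier G" "b \<in> carrier G" "c \<in> carrier G"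
  shows "c \<otimes> (a \<curlywedge> b) = c \<otimes> a \<curlywedge> c \<otimes> b"
proof (rule eq_by_lower)
  fix e assume e: "e \<in> carrier G"
  have *: "e \<preceq> c \<otimes> d \<longleftrightarrow> inv c \<otimes> e \<preceq> d" if "d \<in> carrier G" for d
    using le_translate[of "inv c \<otimes> e" d c] that assms e by (simp add: inv_mult_cancel)
  show "e \<preceq> c \<otimes> (a \<curlywedge> b) \<longleftrightarrow> e \<preceq> c \<otimes> a \<curlywedge> c \<otimes> b"
    using assms e by (simp add: *)
qed (use assms in simp_all)

lemma meet_mult_delta_pow:
  assumes "a \<in> carrier G" "b \<in> carrier G"
  shows "(a \<curlywedge> b) \<otimes> \<delta> [^] (k::int) = a \<otimes> \<delta> [^] k \<curlywedge> b \<otimes> \<delta> [^] k"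
proof (rule eq_by_lower)
  fix e assume e: "e \<in> carrier G"
  have *: "e \<preceq> d \<otimes> \<delta> [^] k \<longleftrightarrow> e \<otimes> inv (\<delta> [^] k) \<preceq> d" if "d \<in> carrier G" for d
    using le_mult_delta_pow[of "e \<otimes> inv (\<delta> [^] k)" d k] that assms e
    by (simp add: m_assoc del: le_mult_delta_pow)
  show "e \<preceq> (a \<curlywedge> b) \<otimes> \<delta> [^] k \<longleftrightarrow> e \<preceq> a \<otimes> \<delta> [^] k \<curlywedge> b \<otimes> \<delta> [^] k"
    using assms e by (simp add: *)
qed (use assms in simp_all)

lemma meet_mult_delta:
  assumes "a \<in> carrier G" "b \<in> carrier G"
  shows "(a \<curlywedge> b) \<otimes> \<delta> = a \<otimes> \<delta> \<curlywedge> b \<otimes> \<delta>"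
  using meet_mult_delta_pow[OF assms, of 1] by simp

lemma meet_absorb:
  assumes "a \<preceq> b" "a \<in> carrier G" "b \<in> carrier G"
  shows "a \<curlywedge> b = a" and "b \<curlywedge> a = a"
  using assms by (auto intro!: meet_eqI intro: le_trans[OF _ assms(1)])

lemma meet_assoc:
  assumes "a \<in> carrier G" "b \<in> carrier G" "c \<in> carrier G"
  shows "a \<curlywedge> b \<curlywedge> c = a \<curlywedge> (b \<curlywedge> c)"
  using assms by (intro eq_by_lower) auto

lemma meet_commute: "a \<curlywedge> b = b \<curlywedge> a"
  by (rule meet_comm)

text \<open>Right multiplication by \<delta>^n distributes over the gcd, and both s \<delta>^n and
  \<delta>^(n+1) are above \<open>s\<close>. Splitting off the largest simple left divisor thus
  lowers the bounding exponent, which drives the inductions for finiteness and for normal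
  forms.\<close>

lemma quotient_le_delta_pow:
  assumes s: "s \<in> M" "s \<preceq> \<delta> [^] Suc n"
  shows "inv (s \<curlywedge> \<delta>) \<otimes> s \<preceq> \<delta> [^] n"
proof -
  let ?u = "s \<curlywedge> \<delta>"
  have uc: "?u \<in> carrier G" using s(1) by simp
  have "\<delta> [^] Suc n = \<delta> \<otimes> \<delta> [^] n" by (rule nat_pow_Suc2) simp
  moreover have "?u \<otimes> \<delta> [^] n = s \<otimes> \<delta> [^] n \<curlywedge> \<delta> \<otimes> \<delta> [^] n"
    using meet_mult_delta_pow[of s \<delta> "int n"] s(1) by (simp add: int_pow_int)
  moreover have "s \<preceq> s \<otimes> \<delta> [^] n"
    using s(1) by (simp add: le_mult delta_pow_cone)
  ultimately have "s \<preceq> ?u \<otimes> \<delta> [^] n" using s by simp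
  then have "?u \<otimes> (inv ?u \<otimes> s) \<preceq> ?u \<otimes> \<delta> [^] n"
    using uc s(1) by (simp add: inv_mult_cancel)
  then show ?thesis
    using uc s(1) le_translate by simp
qed

lemma meet_cone: "\<lbrakk>a \<in> M; b \<in> M\<rbrakk> \<Longrightarrow> a \<curlywedge> b \<in> M"
  using one_le_iff[of "a \<curlywedge> b"] by (simp add: one_le_iff)

lemma finite_below_delta_pow: "finite {s \<in> M. s \<preceq> \<delta> [^] (n::nat)}"
proof (induction n)
  case 0
  have "s = \<one>" if "s \<in> M" "s \<preceq> \<one>" for s
    using that by (intro le_antisym) (simp_all add: one_le_iff)
  then have "{s \<in> M. s \<preceq> \<delta> [^] (0::nat)} \<subseteq> {\<one>}" by auto
  then show ?case using finite_subset by blast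
next
  case (Suc n)
  let ?D = "{s \<in> M. s \<preceq> \<delta>}" and ?E = "{s \<in> M. s \<preceq> \<delta> [^] n}"
  have "{s \<in> M. s \<preceq> \<delta> [^] Suc n} \<subseteq> (\<lambda>(u, v). u \<otimes> v) ` (?D \<times> ?E)"
  proof
    fix s assume "s \<in> {s \<in> M. s \<preceq> \<delta> [^] Suc n}"
    then have s: "s \<in> M" "s \<preceq> \<delta> [^] Suc n" by auto
    let ?u = "s \<curlywedge> \<delta>"
    have "?u \<in> ?D" using s(1) by (simp add: delta_cone meet_cone)
    moreover have "inv ?u \<otimes> s \<in> M" using meet_lower1[of s \<delta>] s(1) by (simp add: le_iff)
    ultimately show "s \<in> (\<lambda>(u, v). u \<otimes> v) ` (?D \<times> ?E)"
      using s quotient_le_delta_pow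
      by (intro image_eqI[of _ _ "(?u, inv ?u \<otimes> s)"]) (simp_all add: inv_mult_cancel)
  qed
  moreover have "finite ?D" using finite_simples by (simp add: le_iff)
  ultimately show ?case using Suc by (auto intro: finite_subset)
qed

end

section \<open>Extrema of bounded sets of integers, products of lists, conjugation\<close>

lemma int_Greatest:
  fixes P :: "int \<Rightarrow> bool"
  assumes "P a" "\<And>k. P k \<Longrightarrow> k \<le> b"
  shows "P (Greatest P)" and "P k \<Longrightarrow> k \<le> Greatest P"
proof -
  \<comment> \<open>Cutting the predicate down to the interval from \<open>a\<close> to
    \<open>b\<close> makes the set finite without changing its maximum.\<close>
  let ?K = "{k. a \<le> k \<and> k \<le> b \<and> P k}"
  have K: "finite ?K" "?K \<noteq> {}"
    using assms by (auto intro: finite_subset[of _ "{a..b}"])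
  have Max: "P (Max ?K)" "a \<le> Max ?K"
    using Max_in[OF K] by auto
  have upper: "k \<le> Max ?K" if "P k" for k
  proof (cases "a \<le> k")
    case True
    then show ?thesis using K assms(2) that by (intro Max_ge) auto
  qed (use Max(2) in simp)
  have "Greatest P = Max ?K"
    using Max upper by (intro Greatest_equality) auto
  then show "P (Greatest P)" and "P k \<Longrightarrow> k \<le> Greatest P"
    using Max upper by auto
qed

lemma int_Least:
  fixes P :: "int \<Rightarrow> bool"
  assumes "P a" "\<And>k. P k \<Longrightarrow> b \<le> k"
  shows "P (Least P)" and "P k \<Longrightarrow> Least P \<le> k"
proof -
  let ?Q = "\<lambda>k. P (- k)"
  have Q: "?Q (Greatest ?Q)" "\<And>k. ?Q k \<Longrightarrow> k \<le> Greatest ?Q"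
    using int_Greatest[of ?Q "- a" "- b"] assms by force+
  have "Least P = - Greatest ?Q"
    using Q(1) Q(2)[of "- k" for k] by (intro Least_equality) force+
  then show "P (Least P)" and "P k \<Longrightarrow> Least P \<le> k"
    using Q(1) Q(2)[of "- k"] by force+
qed

lemma
  fixes G (structure)
  shows list_prod_Nil [simp]: "list_prod G [] = \<one>"
    and list_prod_Cons [simp]: "list_prod G (a # as) = a \<otimes> list_prod G as"
  by (simp_all add: list_prod_def)

lemma (in group) conj_by_closed [simp]:
  "\<lbrakk>y \<in> carrier G; s \<in> carrier G\<rbrakk> \<Longrightarrow> conj_by G y s \<in> carrier G"
  by (simp add: conj_by_def)

lemma (in group) conj_by_mult:
  assumes "y \<in> carrier G" "s \<in> carrier G" "t \<in> carrier G"
  shows "conj_by G (conj_by G y s) t = conj_by G y (s \<otimes> t)"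
  using assms by (simp add: conj_by_def m_assoc inv_mult_group)

lemma (in group) conj_by_one [simp]: "y \<in> carrier G \<Longrightarrow> conj_by G y \<one> = y"
  by (simp add: conj_by_def)

lemma (in group) mult_conj_by:
  "\<lbrakk>y \<in> carrier G; s \<in> carrier G\<rbrakk> \<Longrightarrow> s \<otimes> conj_by G y s = y \<otimes> s"
  by (simp add: conj_by_def m_assoc inv_mult_cancel)

lemma (in group) conj_by_in_conjugates:
  assumes "y \<in> conjugates G x" "s \<in> carrier G" "x \<in> carrier G"
  shows "conj_by G y s \<in> conjugates G x"
proof -
  obtain c where "c \<in> carrier G" "y = conj_by G x c"
    using assms(1) by (auto simp: conjugates_def)
  then have "conj_by G y s = conj_by G x (c \<otimes> s)" "c \<otimes> s \<in> carrier G"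
    using assms by (simp_all add: conj_by_mult)
  then show ?thesis by (auto simp: conjugates_def)
qed

section \<open>Infimum and supremum\<close>

context garside_cone
begin

lemma delta_pow_le_delta_pow [simp]: "\<delta> [^] (k::int) \<preceq> \<delta> [^] (l::int) \<longleftrightarrow> k \<le> l"
proof -
  have mono: "\<delta> [^] k \<preceq> \<delta> [^] l" if "k \<le> l" for k l :: int
  proof -
    have "inv (\<delta> [^] k) \<otimes> \<delta> [^] l = \<delta> [^] (int (nat (l - k)))"
      using that by (simp flip: int_pow_neg int_pow_mult)
    also have "\<dots> \<in> M" unfolding int_pow_int by (rule delta_pow_cone)
    finally show ?thesis by (simp add: le_iff)
  qed
  have "k \<le> l" if le: "\<delta> [^] k \<preceq> \<delta> [^] l"
  proof (rule ccontr)
    assume "\<not> k \<le> l"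
    \<comment> \<open>Now \<delta>^(l+1) lies below \<delta>^l, so the inverse of \<delta> is
      positive. This contradicts pointedness of \<open>M\<close>, as \<delta> is not
      \<open>\<one>\<close>.\<close>
    then have "\<delta> [^] (l + 1) \<preceq> \<delta> [^] k" by (intro mono) simp
    then have "\<delta> [^] (l + 1) \<preceq> \<delta> [^] l" using le by (rule le_trans) simp_all
    then have "inv \<delta> \<in> M"
      by (simp add: le_iff int_pow_mult inv_mult_group m_assoc)
    then show False using cone_pointed delta_cone delta_not_one by blast
  qed
  with mono show ?thesis by blast
qed

text \<open>Powers of \<delta> below and above \<open>y\<close> bound the exponents, so the
  \<open>GREATEST\<close> is attained. The infimum is used through this adjunction from now on, and
  the supremum through \<open>le_delta_pow_iff\<close>.\<close>

lemma delta_pow_le_iff: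
  assumes "y \<in> carrier G"
  shows "\<delta> [^] (k::int) \<preceq> y \<longleftrightarrow> k \<le> \<delta>_inf G M \<delta> y"
proof -
  obtain a b :: nat where ab: "\<delta> [^] (- int a) \<preceq> y" "y \<preceq> \<delta> [^] int b"
    using ex_delta_pow_le[OF assms] ex_le_delta_pow[OF assms] by (auto simp: int_pow_int)
  have "k \<le> int b" if "\<delta> [^] k \<preceq> y" for k :: int
    using le_trans[OF that ab(2)] assms by simp
  from int_Greatest[of "\<lambda>k. \<delta> [^] k \<preceq> y", OF ab(1) this]
  have "\<delta> [^] \<delta>_inf G M \<delta> y \<preceq> y" "\<delta> [^] k \<preceq> y \<Longrightarrow> k \<le> \<delta>_inf G M \<delta> y"
    by (simp_all add: \<delta>_inf_def)
  then show ?thesis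
    using assms le_trans[of "\<delta> [^] k" "\<delta> [^] \<delta>_inf G M \<delta> y" y] by auto
qed

lemma le_delta_pow_iff:
  assumes "y \<in> carrier G"
  shows "y \<preceq> \<delta> [^] (k::int) \<longleftrightarrow> \<delta>_sup G M \<delta> y \<le> k"
proof -
  obtain a b :: nat where ab: "\<delta> [^] (- int a) \<preceq> y" "y \<preceq> \<delta> [^] int b"
    using ex_delta_pow_le[OF assms] ex_le_delta_pow[OF assms] by (auto simp: int_pow_int)
  have "- int a \<le> k" if "y \<preceq> \<delta> [^] k" for k :: int
    using le_trans[OF ab(1) that] assms by simp
  from int_Least[of "\<lambda>k. y \<preceq> \<delta> [^] k", OF ab(2) this]
  have "y \<preceq> \<delta> [^] \<delta>_sup G M \<delta> y" "y \<preceq> \<delta> [^] k \<Longrightarrow> \<delta>_sup G M \<delta> y \<le> k"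
    by (simp_all add: \<delta>_sup_def)
  then show ?thesis
    using assms le_trans[of y "\<delta> [^] \<delta>_sup G M \<delta> y" "\<delta> [^] k"] by auto
qed

lemma inf_le_sup:
  assumes "y \<in> carrier G"
  shows "\<delta>_inf G M \<delta> y \<le> \<delta>_sup G M \<delta> y"
proof -
  have "\<delta> [^] \<delta>_inf G M \<delta> y \<preceq> y" "y \<preceq> \<delta> [^] \<delta>_sup G M \<delta> y"
    using assms by (simp_all add: delta_pow_le_iff le_delta_pow_iff)
  then have "\<delta> [^] \<delta>_inf G M \<delta> y \<preceq> \<delta> [^] \<delta>_sup G M \<delta> y"
    by (rule le_trans) (use assms in simp_all)
  then show ?thesis by simp
qed

section \<open>Normal forms and cycling\<close>

text \<open>The last condition of \<open>is_normal_form\<close>, detached from infimum and length so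
  that lists can be treated by recursion.\<close>

definition left_weighted :: "'a list \<Rightarrow> bool"
  where "left_weighted as \<longleftrightarrow>
    (\<forall>i. Suc i < length as \<longrightarrow> inv (as ! i) \<otimes> \<delta> \<curlywedge> as ! Suc i = \<one>)"

lemma left_weighted_Nil [simp]: "left_weighted []"
  and left_weighted_single [simp]: "left_weighted [a]"
  by (simp_all add: left_weighted_def)

lemma left_weighted_Cons [simp]:
  "left_weighted (a # b # as) \<longleftrightarrow> inv a \<otimes> \<delta> \<curlywedge> b = \<one> \<and> left_weighted (b # as)"
  unfolding left_weighted_def by (auto simp: All_less_Suc2 nth_Cons split: nat.splits)

lemma list_prod_cone: "set as \<subseteq> M \<Longrightarrow> list_prod G as \<in> M"
  by (induction as) (simp_all add: one_cone mult_cone)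

lemma simple_elements_eq: "simple_elements G M \<delta> = {s \<in> M. s \<preceq> \<delta>}"
  by (simp add: simple_elements_def)

text \<open>The condition on neighbours propagates: by induction only the head \<open>b\<close> of
  the tail matters, and what \<open>b\<close> has in common with the complement of \<open>a\<close>
  is trivial. Hence the head can be read off from the product.\<close>

lemma list_prod_meet_delta:
  assumes "as \<noteq> []" "set as \<subseteq> simple_elements G M \<delta>" "left_weighted as"
  shows "list_prod G as \<curlywedge> \<delta> = hd as"
  using assms
proof (induction as)
  case (Cons a as)
  have a: "a \<in> M" "a \<preceq> \<delta>" and as: "set as \<subseteq> M"
    using Cons.prems by (auto simp: simple_elements_eq)
  show ?case
  proof (cases as)
    case Nil
    then show ?thesis using a by (simp add: meet_absorb)
  next
    case (Cons b bs)
    let ?w = "list_prod G as"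
    have w: "?w \<in> carrier G" using as list_prod_cone by simp
    have b: "b \<in> carrier G" using as Cons by simp
    have IH: "?w \<curlywedge> \<delta> = b"
      using Cons.IH Cons.prems Cons by simp
    \<comment> \<open>Inserting a \<delta>, which is above \<delta>, changes nothing but allows
      \<open>a\<close> to be factored out of a gcd.\<close>
    have "a \<otimes> ?w \<curlywedge> \<delta> = a \<otimes> ?w \<curlywedge> (a \<otimes> \<delta> \<curlywedge> \<delta>)"
      using a by (simp add: meet_absorb(2) le_delta_mult)
    also have "\<dots> = a \<otimes> b \<curlywedge> \<delta>"
      using a(1) w IH by (simp add: mult_meet flip: meet_assoc IH)
    also have "\<dots> = a \<otimes> (inv a \<otimes> \<delta> \<curlywedge> b)"
      using a(1) b by (simp add: mult_meet inv_mult_cancel meet_commute)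
    finally show ?thesis
      using Cons.prems a(1) Cons by simp
  qed
qed simp

text \<open>Greedy factorisation: the head is the gcd with \<delta>, and the quotient is bounded by
  the next lower power. The length is exactly \<open>n\<close> because trailing entries
  \<open>\<one>\<close> are permitted.\<close>

lemma ex_normal_form:
  assumes "w \<in> M" "w \<preceq> \<delta> [^] (n::nat)"
  shows "\<exists>as. length as = n \<and> set as \<subseteq> simple_elements G M \<delta> \<and> left_weighted as \<and>
    list_prod G as = w"
  using assms
proof (induction n arbitrary: w)
  case 0
  then have "w = \<one>" by (intro le_antisym) (simp_all add: one_le_iff)
  then show ?case by simp
next
  case (Suc n)
  let ?a = "w \<curlywedge> \<delta>"
  let ?v = "inv ?a \<otimes> w"
  have a: "?a \<in> M" "?a \<preceq> \<delta>" using Suc.prems by (simp_all add: meet_cone delta_cone)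
  have v: "?v \<in> M" using meet_lower1[of w \<delta>] Suc.prems by (simp add: le_iff)
  obtain as where as: "length as = n" "set as \<subseteq> simple_elements G M \<delta>" "left_weighted as"
      "list_prod G as = ?v"
    using Suc.IH[OF v quotient_le_delta_pow] Suc.prems by blast
  have "left_weighted (?a # as)"
  proof (cases as)
    case (Cons b bs)
    have "b = ?v \<curlywedge> \<delta>"
      using list_prod_meet_delta[of as] as Cons by simp
    \<comment> \<open>Dividing \<delta> and \<open>w\<close> by their gcd leaves coprime elements,
      and \<open>b\<close> is a divisor of the second one.\<close>
    moreover have "inv ?a \<otimes> \<delta> \<curlywedge> ?v = \<one>"
      using mult_meet[of \<delta> w "inv ?a"] Suc.prems by (simp add: meet_commute[of \<delta> w])
    ultimately have "inv ?a \<otimes> \<delta> \<curlywedge> b = \<one> \<curlywedge> \<delta>"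
      using meet_assoc[of "inv ?a \<otimes> \<delta>" ?v \<delta>] Suc.prems by simp
    also have "\<dots> = \<one>" by (simp add: meet_absorb one_le_iff delta_cone)
    finally show ?thesis using as(3) Cons by simp
  qed simp
  moreover have "list_prod G (?a # as) = w"
    using as(4) Suc.prems by (simp add: inv_mult_cancel)
  moreover have "set (?a # as) \<subseteq> simple_elements G M \<delta>"
    using as(2) a by (simp add: simple_elements_eq)
  ultimately show ?case using as(1) by (metis length_Cons)
qed

text \<open>The product determines the head, by \<open>list_prod_meet_delta\<close>, and cancelling
  it leaves the tails. Equal lengths are assumed since trailing entries \<open>\<one>\<close> do not
  change the product.\<close>

lemma left_weighted_unique:
  assumes "length as = length bs" "set as \<subseteq> simple_elements G M \<delta>"
    "set bs \<subseteq> simple_elements G M \<delta>" "left_weighted as" "left_weighted bs"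
    "list_prod G as = list_prod G bs"
  shows "as = bs"
  using assms
proof (induction as bs rule: list_induct2)
  case (Cons a as b bs)
  have "set as \<subseteq> M" "set bs \<subseteq> M" "a \<in> M"
    using Cons.prems by (auto simp: simple_elements_eq)
  moreover have "a = b"
    using list_prod_meet_delta[of "a # as"] list_prod_meet_delta[of "b # bs"] Cons.prems by simp
  moreover have "left_weighted as" "left_weighted bs"
    using Cons.prems by (cases as; cases bs; simp)+
  ultimately show ?case
    using Cons by (simp add: list_prod_cone)
qed simp

text \<open>Justifies the definite description. Dividing \<open>y\<close> by \<delta> to the power
  of its infimum leaves a positive element below \<delta> to the canonical length; it has a greedy
  factorisation, unique because its length is prescribed.\<close>

lemma is_normal_form_normal_form:
  assumes "y \<in> carrier G"
  shows "is_normal_form G M \<delta> y (normal_form G M \<delta> y)"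
proof -
  let ?i = "\<delta>_inf G M \<delta> y" and ?s = "\<delta>_sup G M \<delta> y"
  let ?w = "inv (\<delta> [^] ?i) \<otimes> y"
  have w: "?w \<in> M"
    using delta_pow_le_iff[OF assms, of ?i] by (simp add: le_iff)
  have y: "y = \<delta> [^] ?i \<otimes> ?w" using assms by (simp add: inv_mult_cancel)
  have "\<delta> [^] ?s = \<delta> [^] ?i \<otimes> \<delta> [^] (nat (?s - ?i))"
    using inf_le_sup[OF assms] by (simp flip: int_pow_int int_pow_mult)
  then have "?w \<preceq> \<delta> [^] (nat (?s - ?i))"
    using le_delta_pow_iff[OF assms, of ?s] y w by (metis le_translate cone_carrier delta_carrier
        int_pow_closed nat_pow_closed order_refl)
  with w obtain as where as: "length as = nat (?s - ?i)" "set as \<subseteq> simple_elements G M \<delta>"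
      "left_weighted as" "list_prod G as = ?w"
    using ex_normal_form by blast
  show ?thesis
    unfolding normal_form_def
  proof (rule theI)
    show "is_normal_form G M \<delta> y as"
      using as y inf_le_sup[OF assms]
      by (simp add: is_normal_form_def canonical_length_def left_weighted_def)
    fix bs assume bs: "is_normal_form G M \<delta> y bs"
    then have "set bs \<subseteq> M" by (auto simp: is_normal_form_def simple_elements_eq)
    moreover have "y = \<delta> [^] ?i \<otimes> list_prod G bs"
      using bs unfolding is_normal_form_def by blast
    ultimately have "list_prod G bs = ?w"
      by (metis inv_mult_cancel(1) list_prod_cone cone_carrier delta_carrier int_pow_closed)
    moreover have "int (length bs) = ?s - ?i" "set bs \<subseteq> simple_elements G M \<delta>" "left_weighted bs"
      using bs unfolding is_normal_form_def canonical_length_def left_weighted_def by blast+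
    ultimately show "bs = as"
      using as by (intro left_weighted_unique) simp_all
  qed
qed

text \<open>In canonical length \<open>0\<close> this is \<open>\<one>\<close>, so that case of cycling needs no separate treatment.\<close>

definition cycling_conjugator :: "'a \<Rightarrow> 'a"
  where "cycling_conjugator y = y \<otimes> \<delta> [^] (- \<delta>_inf G M \<delta> y) \<curlywedge> \<delta>"

lemma cycling_conjugator_closed [simp]:
  "y \<in> carrier G \<Longrightarrow> cycling_conjugator y \<in> carrier G"
  by (simp add: cycling_conjugator_def)

lemma canonical_length_eq_0:
  assumes "y \<in> carrier G" "canonical_length G M \<delta> y = 0"
  shows "y = \<delta> [^] \<delta>_inf G M \<delta> y"
  using assms delta_pow_le_iff[of y "\<delta>_inf G M \<delta> y"] le_delta_pow_iff[of y "\<delta>_inf G M \<delta> y"]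
  by (intro le_antisym) (simp_all add: canonical_length_def)

text \<open>The first factor is w \<curlywedge> \<delta> for the positive part \<open>w\<close>.
  Conjugating it by \<delta>^(-k), \<open>k\<close> being the infimum, turns \<delta>^k w
  \<delta>^(-k) into y \<delta>^(-k) and fixes \<delta>. Cycling becomes a gcd formula, free of
  normal forms.\<close>

lemma cycling_eq:
  assumes y: "y \<in> carrier G"
  shows "cycling G M \<delta> y = conj_by G y (cycling_conjugator y)"
proof (cases "canonical_length G M \<delta> y = 0")
  case True
  then have "y = \<delta> [^] \<delta>_inf G M \<delta> y" by (rule canonical_length_eq_0[OF y])
  then have "y \<otimes> \<delta> [^] (- \<delta>_inf G M \<delta> y) = \<one>"
    using y by (metis delta_carrier int_pow_closed int_pow_neg r_inv)
  then have "cycling_conjugator y = \<one>"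
    by (simp add: cycling_conjugator_def meet_absorb one_le_iff delta_cone)
  with True y show ?thesis by (simp add: cycling_def)
next
  case False
  let ?as = "normal_form G M \<delta> y" and ?i = "\<delta>_inf G M \<delta> y"
  have nf: "int (length ?as) = canonical_length G M \<delta> y" "set ?as \<subseteq> simple_elements G M \<delta>"
      "left_weighted ?as" "y = \<delta> [^] ?i \<otimes> list_prod G ?as"
    using is_normal_form_normal_form[OF y] by (simp_all add: is_normal_form_def left_weighted_def)
  have w: "list_prod G ?as \<in> carrier G"
    using nf(2) by (intro cone_carrier list_prod_cone) (auto simp: simple_elements_eq)
  have "hd ?as = list_prod G ?as \<curlywedge> \<delta>"
    using nf False by (metis list_prod_meet_delta list.size(3) of_nat_0)
  then have "tau_pow G \<delta> (- ?i) (hd ?as) = \<delta> [^] ?i \<otimes> (list_prod G ?as \<curlywedge> \<delta>) \<otimes> \<delta> [^] (- ?i)"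
    by (simp add: tau_pow_def conj_by_def int_pow_neg)
  also have "\<dots> = y \<otimes> \<delta> [^] (- ?i) \<curlywedge> \<delta> [^] ?i \<otimes> \<delta> \<otimes> \<delta> [^] (- ?i)"
    using w y by (simp add: mult_meet meet_mult_delta_pow flip: nf(4))
  also have "\<delta> [^] ?i \<otimes> \<delta> \<otimes> \<delta> [^] (- ?i) = \<delta>"
    using int_pow_mult[of \<delta> ?i 1] int_pow_mult[of \<delta> "?i + 1" "- ?i"] by simp
  finally show ?thesis
    using False by (simp add: cycling_def cycling_conjugator_def)
qed

lemma cycling_closed [simp]: "y \<in> carrier G \<Longrightarrow> cycling G M \<delta> y \<in> carrier G"
  by (simp add: cycling_eq)

end

section \<open>Periodic points of injective maps\<close>

lemma inj_on_finite_periodic: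
  assumes "finite A" "f ` A \<subseteq> A" "inj_on f A" "a \<in> A"
  shows "\<exists>n>0. (f ^^ n) a = a"
proof -
  have in_A: "(f ^^ n) a \<in> A" for n
    using assms(2,4) by (induction n) auto
  then have "\<not> inj (\<lambda>n. (f ^^ n) a)"
    using assms(1) by (meson finite_subset image_subsetI infinite_UNIV_nat finite_imageD)
  then obtain i j where "i < j" and eq: "(f ^^ i) a = (f ^^ j) a"
    unfolding inj_def by (metis nat_neq_iff)
  then obtain d where d: "j = i + d" "d > 0"
    using less_imp_add_positive by blast
  \<comment> \<open>The pigeonhole principle only gives an eventual period; injectivity on
    \<open>A\<close> removes the \<open>i\<close> leading applications one by one.\<close>
  have "(f ^^ i) a = (f ^^ (i + d)) a \<Longrightarrow> a = (f ^^ d) a" for i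
  proof (induction i)
    case (Suc i)
    then show ?case
      using inj_onD[OF assms(3), of "(f ^^ i) a" "(f ^^ (i + d)) a"] in_A by simp
  qed simp
  with d eq show ?thesis by metis
qed

lemma funpow_mult_fixed: "(f ^^ k) y = y \<Longrightarrow> (f ^^ (k * m)) y = y"
  by (induction m) (simp_all add: funpow_add)

context garside_cone
begin

lemma meet_mono:
  assumes "a \<preceq> a'" "b \<preceq> b'" "a \<in> carrier G" "a' \<in> carrier G" "b \<in> carrier G" "b' \<in> carrier G"
  shows "a \<curlywedge> b \<preceq> a' \<curlywedge> b'"
  using assms le_trans[of "a \<curlywedge> b" a a'] le_trans[of "a \<curlywedge> b" b b'] by simp

section \<open>Transport along cycling\<close>

lemma delta_pow_le_conj_by_iff:
  assumes "y \<in> carrier G" "s \<in> carrier G"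
  shows "\<delta> [^] (k::int) \<preceq> conj_by G y s \<longleftrightarrow> s \<otimes> \<delta> [^] k \<preceq> y \<otimes> s"
  using le_translate[of "\<delta> [^] k" "conj_by G y s" s] assms
  by (simp add: mult_conj_by del: le_translate)

lemma conj_by_le_delta_pow_iff:
  assumes "y \<in> carrier G" "s \<in> carrier G"
  shows "conj_by G y s \<preceq> \<delta> [^] (k::int) \<longleftrightarrow> y \<otimes> s \<preceq> s \<otimes> \<delta> [^] k"
  using le_translate[of "conj_by G y s" "\<delta> [^] k" s] assms
  by (simp add: mult_conj_by del: le_translate)

lemma super_summit_set_carrier:
  assumes "x \<in> carrier G" "y \<in> super_summit_set G M \<delta> x"
  shows "y \<in> carrier G"
  using assms by (auto simp: super_summit_set_def conjugates_def)

lemma super_summit_set_extremal: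
  assumes "y \<in> super_summit_set G M \<delta> x" "z \<in> super_summit_set G M \<delta> x"
  shows "\<delta>_inf G M \<delta> y = \<delta>_inf G M \<delta> z" "\<delta>_sup G M \<delta> y = \<delta>_sup G M \<delta> z"
  using assms by (auto simp: super_summit_set_def intro: antisym)

text \<open>As \<open>y\<close> is already extremal, it is enough that conjugation does not worsen
  infimum and supremum. Multiplying by \<open>s\<close> gives inequalities in which all operations
  on \<open>s\<close> distribute over gcds.\<close>

lemma conj_by_super_summit_set_iff:
  assumes x: "x \<in> carrier G" and y: "y \<in> super_summit_set G M \<delta> x" and s: "s \<in> carrier G"
  shows "conj_by G y s \<in> super_summit_set G M \<delta> x \<longleftrightarrow>
    s \<otimes> \<delta> [^] \<delta>_inf G M \<delta> y \<preceq> y \<otimes> s \<and> y \<otimes> s \<preceq> s \<otimes> \<delta> [^] \<delta>_sup G M \<delta> y"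
    (is "?z \<in> _ \<longleftrightarrow> ?R")
proof -
  have yc: "y \<in> carrier G" using super_summit_set_carrier x y by blast
  have R: "?R \<longleftrightarrow> \<delta>_inf G M \<delta> y \<le> \<delta>_inf G M \<delta> ?z \<and> \<delta>_sup G M \<delta> ?z \<le> \<delta>_sup G M \<delta> y"
    unfolding delta_pow_le_conj_by_iff[OF yc s, symmetric] conj_by_le_delta_pow_iff[OF yc s, symmetric]
      delta_pow_le_iff[OF conj_by_closed[OF yc s]] le_delta_pow_iff[OF conj_by_closed[OF yc s]]
    by (rule refl)
  have z: "?z \<in> conjugates G x"
    using conj_by_in_conjugates s x y by (simp add: super_summit_set_def)
  show ?thesis
  proof
    assume "?z \<in> super_summit_set G M \<delta> x"
    from super_summit_set_extremal[OF y this] show ?R unfolding R by simp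
  next
    assume ?R
    then show "?z \<in> super_summit_set G M \<delta> x"
      using y z unfolding R super_summit_set_def by (auto intro: order_trans)
  qed
qed

text \<open>Both inequalities of \<open>conj_by_super_summit_set_iff\<close> survive taking gcds, by
  distributivity and monotonicity.\<close>

lemma conj_by_meet_super_summit_set:
  assumes x: "x \<in> carrier G" and y: "y \<in> super_summit_set G M \<delta> x"
    and s: "s \<in> carrier G" "conj_by G y s \<in> super_summit_set G M \<delta> x"
    and t: "t \<in> carrier G" "conj_by G y t \<in> super_summit_set G M \<delta> x"
  shows "conj_by G y (s \<curlywedge> t) \<in> super_summit_set G M \<delta> x"
proof -
  have yc: "y \<in> carrier G" using super_summit_set_carrier x y by blast
  show ?thesis
    using s t yc
    by (simp only: conj_by_super_summit_set_iff[OF x y] meet_closed mult_meet meet_mult_delta_pow)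
      (simp add: meet_mono del: le_meet_iff)
qed

lemma conj_by_delta_super_summit_set:
  assumes x: "x \<in> carrier G" and y: "y \<in> super_summit_set G M \<delta> x"
  shows "conj_by G y \<delta> \<in> super_summit_set G M \<delta> x"
proof -
  have yc: "y \<in> carrier G" using super_summit_set_carrier x y by blast
  have "\<delta> \<otimes> \<delta> [^] k = \<delta> [^] k \<otimes> \<delta>" for k :: int
    using int_pow_mult[of \<delta> 1 k] int_pow_mult[of \<delta> k 1] by (simp add: add.commute)
  then show ?thesis
    using yc by (simp add: conj_by_super_summit_set_iff[OF x y] delta_pow_le_iff le_delta_pow_iff)
qed

lemma cycling_conjugator_cone:
  assumes "y \<in> carrier G"
  shows "cycling_conjugator y \<in> M"
proof -
  let ?i = "\<delta>_inf G M \<delta> y"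
  have "\<delta> [^] ?i \<otimes> \<delta> [^] (- ?i) \<preceq> y \<otimes> \<delta> [^] (- ?i)"
    using assms by (simp add: delta_pow_le_iff)
  then have "y \<otimes> \<delta> [^] (- ?i) \<in> M"
    using assms by (simp add: one_le_iff int_pow_neg)
  then show ?thesis
    by (simp add: cycling_conjugator_def meet_cone delta_cone)
qed

lemma cycling_super_summit_set:
  assumes x: "x \<in> carrier G" and y: "y \<in> super_summit_set G M \<delta> x"
  shows "cycling G M \<delta> y \<in> super_summit_set G M \<delta> x"
proof -
  let ?a = "cycling_conjugator y" and ?i = "\<delta>_inf G M \<delta> y" and ?s = "\<delta>_sup G M \<delta> y"
  let ?p = "y \<otimes> \<delta> [^] (- ?i)"
  have yc: "y \<in> carrier G" using super_summit_set_carrier x y by blast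
  have a: "?a \<in> carrier G" "?a \<preceq> ?p" "?a \<preceq> \<delta>"
    using yc by (simp_all add: cycling_conjugator_def)
  \<comment> \<open>For the infimum: \<open>?a\<close> is below \<open>?p\<close>, so a \<delta>^i
    is below \<open>y\<close>, which is below y a because \<open>?a\<close> is positive.\<close>
  have "?a \<otimes> \<delta> [^] ?i \<preceq> ?p \<otimes> \<delta> [^] ?i"
    using a yc by simp
  then have "?a \<otimes> \<delta> [^] ?i \<preceq> y"
    using yc by (simp add: m_assoc int_pow_neg)
  then have lower: "?a \<otimes> \<delta> [^] ?i \<preceq> y \<otimes> ?a"
    by (rule le_trans) (use a yc in \<open>simp_all add: le_mult cycling_conjugator_cone\<close>)
  \<comment> \<open>For the supremum, a \<delta>^s is the gcd of p \<delta>^s and \<delta>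
    \<delta>^s. The element y a is below the first since \<open>?a\<close> is below
    \<open>?p\<close>, hence below \<delta>^(s-i), and below the second since \<open>?a\<close> is
    below \<delta>.\<close>
  have "?p \<preceq> \<delta> [^] ?s \<otimes> \<delta> [^] (- ?i)"
    using yc by (simp add: le_delta_pow_iff)
  then have "?a \<preceq> \<delta> [^] ?s \<otimes> \<delta> [^] (- ?i)"
    by (rule le_trans[OF a(2)]) (use a yc in simp_all)
  moreover have "\<delta> [^] ?s \<otimes> \<delta> [^] (- ?i) = \<delta> [^] (- ?i) \<otimes> \<delta> [^] ?s"
    by (simp flip: int_pow_mult add: add.commute)
  ultimately have "y \<otimes> ?a \<preceq> ?p \<otimes> \<delta> [^] ?s"
    using a yc by (simp add: m_assoc)
  moreover have "y \<otimes> \<delta> \<preceq> \<delta> [^] ?s \<otimes> \<delta>"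
    using yc by (simp add: le_delta_pow_iff)
  then have "y \<otimes> ?a \<preceq> \<delta> [^] ?s \<otimes> \<delta>"
    by (rule le_trans[rotated]) (use a yc in simp_all)
  moreover have "\<delta> [^] ?s \<otimes> \<delta> = \<delta> \<otimes> \<delta> [^] ?s"
    using int_pow_mult[of \<delta> 1 ?s] int_pow_mult[of \<delta> ?s 1] by (simp add: add.commute)
  moreover have "?a \<otimes> \<delta> [^] ?s = ?p \<otimes> \<delta> [^] ?s \<curlywedge> \<delta> \<otimes> \<delta> [^] ?s"
    using yc by (simp add: cycling_conjugator_def meet_mult_delta_pow)
  ultimately have upper: "y \<otimes> ?a \<preceq> ?a \<otimes> \<delta> [^] ?s"
    using yc a by simp
  show ?thesis
    using lower upper a yc by (simp add: cycling_eq conj_by_super_summit_set_iff[OF x y])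
qed

text \<open>
  Where \<open>y\<close> and \<open>y\<^sup>s\<close> have the same infimum this is \<open>a(y)\<^sup>-\<^sup>1 s a(y\<^sup>s)\<close>; the expression chosen as the
  definition makes the compatibility with gcds visible.
\<close>

definition transport :: "'a \<Rightarrow> 'a \<Rightarrow> 'a"
  where "transport y s = inv (cycling_conjugator y) \<otimes>
    (y \<otimes> s \<otimes> \<delta> [^] (- \<delta>_inf G M \<delta> y) \<curlywedge> s \<otimes> \<delta>)"

lemma transport_closed [simp]:
  "\<lbrakk>y \<in> carrier G; s \<in> carrier G\<rbrakk> \<Longrightarrow> transport y s \<in> carrier G"
  by (simp add: transport_def)

text \<open>Since \<open>s\<close> times the conjugate equals y s, the factor \<open>s\<close> comes
  out of the gcd. Equal infima ensure that what remains is the cycling conjugator of the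
  conjugate.\<close>

lemma transport_eq:
  assumes "y \<in> carrier G" "s \<in> carrier G" "\<delta>_inf G M \<delta> (conj_by G y s) = \<delta>_inf G M \<delta> y"
  shows "transport y s =
    inv (cycling_conjugator y) \<otimes> (s \<otimes> cycling_conjugator (conj_by G y s))"
  using assms
  by (simp add: transport_def cycling_conjugator_def[of "conj_by G y s"] mult_meet mult_conj_by
      flip: m_assoc)

lemma conj_by_cycling_transport:
  assumes "y \<in> carrier G" "s \<in> carrier G" "\<delta>_inf G M \<delta> (conj_by G y s) = \<delta>_inf G M \<delta> y"
  shows "conj_by G (cycling G M \<delta> y) (transport y s) = cycling G M \<delta> (conj_by G y s)"
  using assms
  by (simp add: cycling_eq conj_by_mult transport_eq inv_mult_cancel)

lemma transport_meet:
  assumes "y \<in> carrier G" "s \<in> carrier G" "t \<in> carrier G"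
  shows "transport y (s \<curlywedge> t) = transport y s \<curlywedge> transport y t"
proof -
  let ?e = "\<delta> [^] (- \<delta>_inf G M \<delta> y)"
  have "y \<otimes> (s \<curlywedge> t) \<otimes> ?e \<curlywedge> (s \<curlywedge> t) \<otimes> \<delta>
      = (y \<otimes> s \<otimes> ?e \<curlywedge> y \<otimes> t \<otimes> ?e) \<curlywedge> (s \<otimes> \<delta> \<curlywedge> t \<otimes> \<delta>)"
    using assms by (simp add: mult_meet meet_mult_delta_pow meet_mult_delta)
  also have "\<dots> = (y \<otimes> s \<otimes> ?e \<curlywedge> s \<otimes> \<delta>) \<curlywedge> (y \<otimes> t \<otimes> ?e \<curlywedge> t \<otimes> \<delta>)"
    using assms by (intro eq_by_lower) auto
  finally show ?thesis
    using assms by (simp add: transport_def mult_meet)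
qed

lemma transport_mono:
  assumes "s \<preceq> t" "y \<in> carrier G" "s \<in> carrier G" "t \<in> carrier G"
  shows "transport y s \<preceq> transport y t"
  using assms meet_lower2[of "transport y s" "transport y t"]
  by (simp add: meet_absorb(1) flip: transport_meet)

text \<open>A power of \<delta> can be moved to the far right in both terms of the gcd, leaving the
  cycling conjugator, which cancels.\<close>

lemma transport_delta_pow [simp]:
  assumes "y \<in> carrier G"
  shows "transport y (\<delta> [^] (k::int)) = \<delta> [^] k"
proof -
  have "\<delta> [^] k \<otimes> \<delta> = \<delta> \<otimes> \<delta> [^] k"
    using int_pow_mult[of \<delta> 1 k] int_pow_mult[of \<delta> k 1] by (simp add: add.commute)
  moreover have "y \<otimes> \<delta> [^] k \<otimes> \<delta> [^] l = y \<otimes> \<delta> [^] l \<otimes> \<delta> [^] k" for l :: int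
    using assms by (simp add: m_assoc add.commute flip: int_pow_mult)
  ultimately have "transport y (\<delta> [^] k)
      = inv (cycling_conjugator y) \<otimes> (cycling_conjugator y \<otimes> \<delta> [^] k)"
    using assms by (simp add: transport_def cycling_conjugator_def meet_mult_delta_pow)
  then show ?thesis using assms by (simp add: inv_mult_cancel)
qed

text \<open>Transport is monotone and fixes both \<open>\<one>\<close> and \<delta>^n. It therefore
  acts within a finite interval, as the periodicity argument requires.\<close>

lemma transport_below_delta_pow:
  assumes "y \<in> carrier G" "s \<in> M" "s \<preceq> \<delta> [^] (n::nat)"
  shows "transport y s \<in> M" "transport y s \<preceq> \<delta> [^] n"
proof -
  have "\<one> \<preceq> s" using assms(2) by (simp add: one_le_iff)
  then have "transport y \<one> \<preceq> transport y s" using assms by (intro transport_mono) simp_all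
  then show "transport y s \<in> M"
    using transport_delta_pow[OF assms(1), of 0] assms by (simp add: one_le_iff)
  have "transport y s \<preceq> transport y (\<delta> [^] n)" using assms by (intro transport_mono) simp_all
  then show "transport y s \<preceq> \<delta> [^] n"
    using transport_delta_pow[OF assms(1), of "int n"] by (simp add: int_pow_int)
qed

text \<open>Not a plain iterate of one map: the base point moves along the cycling orbit with each
  transport.\<close>

primrec transports :: "nat \<Rightarrow> 'a \<Rightarrow> 'a \<Rightarrow> 'a"
  where "transports 0 y s = s"
  | "transports (Suc n) y s = transports n (cycling G M \<delta> y) (transport y s)"

lemma transports_meet:
  assumes "y \<in> carrier G" "s \<in> carrier G" "t \<in> carrier G"
  shows "transports n y (s \<curlywedge> t) = transports n y s \<curlywedge> transports n y t"
  using assms by (induction n arbitrary: y s t) (simp_all add: transport_meet)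

lemma transports_delta: "y \<in> carrier G \<Longrightarrow> transports n y \<delta> = \<delta>"
  using transport_delta_pow[of _ 1] by (induction n arbitrary: y) simp_all

text \<open>Super summit membership survives cycling and provides the equal infima at every step. If
  \<open>n\<close> cyclings fix \<open>y\<close> and \<open>n\<close> transports fix
  \<open>s\<close>, it follows that \<open>n\<close> cyclings fix the conjugate, which is how ultra
  summit membership will be obtained.\<close>

lemma conj_by_transports:
  assumes "x \<in> carrier G" "y \<in> super_summit_set G M \<delta> x" "s \<in> carrier G"
    "conj_by G y s \<in> super_summit_set G M \<delta> x"
  shows "conj_by G ((cycling G M \<delta> ^^ n) y) (transports n y s) = (cycling G M \<delta> ^^ n) (conj_by G y s)"
  using assms(2-)
proof (induction n arbitrary: y s)
  case (Suc n)
  have y: "y \<in> carrier G" using super_summit_set_carrier assms(1) Suc.prems(1) by blast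
  have eq: "conj_by G (cycling G M \<delta> y) (transport y s) = cycling G M \<delta> (conj_by G y s)"
    using y Suc.prems super_summit_set_extremal by (intro conj_by_cycling_transport) blast+
  then have "conj_by G (cycling G M \<delta> y) (transport y s) \<in> super_summit_set G M \<delta> x"
    using cycling_super_summit_set assms(1) Suc.prems by simp
  with Suc.IH[of "cycling G M \<delta> y" "transport y s"] eq show ?case
    using y Suc.prems cycling_super_summit_set assms(1)
    by (simp add: funpow_Suc_right del: funpow.simps)
qed simp

section \<open>Ultra summit sets\<close>

lemma ultra_summit_setD: "y \<in> ultra_summit_set G M \<delta> x \<Longrightarrow> y \<in> super_summit_set G M \<delta> x"
  by (simp add: ultra_summit_set_def)

lemma ultra_summit_set_carrier:
  assumes "x \<in> carrier G" "y \<in> ultra_summit_set G M \<delta> x"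
  shows "y \<in> carrier G"
  using super_summit_set_carrier assms ultra_summit_setD by blast

lemma cycling_ultra_summit_set:
  assumes "x \<in> carrier G" "y \<in> ultra_summit_set G M \<delta> x"
  shows "cycling G M \<delta> y \<in> ultra_summit_set G M \<delta> x"
proof -
  obtain k where "k > 0" "(cycling G M \<delta> ^^ k) y = y"
    using assms(2) by (auto simp: ultra_summit_set_def)
  moreover from this have "(cycling G M \<delta> ^^ k) (cycling G M \<delta> y) = cycling G M \<delta> y"
    by (simp flip: funpow_swap1)
  ultimately show ?thesis
    using cycling_super_summit_set[OF assms(1)] assms(2) by (auto simp: ultra_summit_set_def)
qed

lemma inj_on_cycling: "inj_on (cycling G M \<delta>) (ultra_summit_set G M \<delta> x)"
proof (rule inj_onI)
  fix y z assume yz: "y \<in> ultra_summit_set G M \<delta> x" "z \<in> ultra_summit_set G M \<delta> x"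
    and eq: "cycling G M \<delta> y = cycling G M \<delta> z"
  obtain k l where kl: "k > 0" "(cycling G M \<delta> ^^ k) y = y" "l > 0" "(cycling G M \<delta> ^^ l) z = z"
    using yz by (auto simp: ultra_summit_set_def)
  \<comment> \<open>The product is a common period of \<open>y\<close> and \<open>z\<close>; being
    positive, it lets a first cycling step be split off, where the two agree.\<close>
  then obtain n where n: "k * l = Suc n"
    by (metis gr0_implies_Suc nat_0_less_mult_iff)
  have "y = (cycling G M \<delta> ^^ Suc n) y" "z = (cycling G M \<delta> ^^ Suc n) z"
    using funpow_mult_fixed[OF kl(2), of l] funpow_mult_fixed[OF kl(4), of k] n
    by (simp_all add: mult.commute)
  then show "y = z"
    unfolding funpow_Suc_right o_def by (metis eq)
qed

text \<open>Every transport fixes \<delta>, so any period of \<open>y\<close> under cycling is a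
  period of its conjugate by \<delta>.\<close>

lemma conj_by_delta_ultra_summit_set:
  assumes x: "x \<in> carrier G" and y: "y \<in> ultra_summit_set G M \<delta> x"
  shows "conj_by G y \<delta> \<in> ultra_summit_set G M \<delta> x"
proof -
  have S: "conj_by G y \<delta> \<in> super_summit_set G M \<delta> x"
    using conj_by_delta_super_summit_set x y ultra_summit_setD by blast
  obtain k where "k > 0" "(cycling G M \<delta> ^^ k) y = y"
    using y by (auto simp: ultra_summit_set_def)
  then show ?thesis
    using conj_by_transports[OF x ultra_summit_setD[OF y] _ S, of k] S
      ultra_summit_set_carrier[OF x y]
    by (auto simp: ultra_summit_set_def transports_delta)
qed

text \<open>Equal transports give conjugates with equal cycling, hence equal conjugates by
  \<open>inj_on_cycling\<close>. Then the same cycling conjugators stand on both sides of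
  \<open>transport_eq\<close> and cancel.\<close>

lemma transport_inj:
  assumes "x \<in> carrier G" "y \<in> ultra_summit_set G M \<delta> x" "s \<in> carrier G" "t \<in> carrier G"
    and S: "conj_by G y s \<in> ultra_summit_set G M \<delta> x" "conj_by G y t \<in> ultra_summit_set G M \<delta> x"
    and eq: "transport y s = transport y t"
  shows "s = t"
proof -
  have y: "y \<in> carrier G" using ultra_summit_set_carrier assms(1,2) by blast
  have inf: "\<delta>_inf G M \<delta> (conj_by G y s) = \<delta>_inf G M \<delta> y"
      "\<delta>_inf G M \<delta> (conj_by G y t) = \<delta>_inf G M \<delta> y"
    using super_summit_set_extremal(1) ultra_summit_setD assms by meson+
  have "cycling G M \<delta> (conj_by G y s) = cycling G M \<delta> (conj_by G y t)"
    using eq inf y assms by (simp flip: conj_by_cycling_transport)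
  then have "conj_by G y s = conj_by G y t"
    using inj_on_cycling S by (auto dest: inj_onD)
  then show ?thesis
    using eq inf y assms(3,4) by (simp add: transport_eq)
qed

text \<open>Both conjugators are transported at once, so that a single \<open>n\<close> returns
  \<open>y\<close>, \<open>s\<close> and \<open>t\<close>; then \<open>n\<close> transports also fix
  their gcd.\<close>

lemma conj_by_meet_ultra_summit_set:
  assumes x: "x \<in> carrier G" and y: "y \<in> ultra_summit_set G M \<delta> x"
    and s: "s \<in> M" "conj_by G y s \<in> ultra_summit_set G M \<delta> x"
    and t: "t \<in> M" "conj_by G y t \<in> ultra_summit_set G M \<delta> x"
  shows "conj_by G y (s \<curlywedge> t) \<in> ultra_summit_set G M \<delta> x"
proof -
  let ?c = "cycling G M \<delta>" and ?U = "ultra_summit_set G M \<delta> x"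
  let ?F = "\<lambda>(z, u, v). (?c z, transport z u, transport z v)"
  obtain k l :: nat where kl: "s \<preceq> \<delta> [^] k" "t \<preceq> \<delta> [^] l"
    using ex_le_delta_pow s(1) t(1) cone_carrier by meson
  \<comment> \<open>Base points are confined to the cycling orbit of \<open>y\<close>, which is
    finite because \<open>y\<close> is periodic; conjugators are confined to finite
    intervals.\<close>
  define A where "A = {(z, u, v). z \<in> range (\<lambda>n. (?c ^^ n) y) \<and> z \<in> ?U \<and>
    (u \<in> M \<and> u \<preceq> \<delta> [^] k \<and> conj_by G z u \<in> ?U) \<and>
    (v \<in> M \<and> v \<preceq> \<delta> [^] l \<and> conj_by G z v \<in> ?U)}"
  have carrier: "z \<in> carrier G" if "z \<in> ?U" for z
    using ultra_summit_set_carrier x that by blast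
  have conj: "conj_by G (?c z) (transport z u) = ?c (conj_by G z u)"
    if "z \<in> ?U" "u \<in> M" "conj_by G z u \<in> ?U" for z u
    using that carrier super_summit_set_extremal(1) ultra_summit_setD
    by (intro conj_by_cycling_transport) (meson cone_carrier)+
  have "finite A"
  proof -
    obtain n where "n > 0" "(?c ^^ n) y = y"
      using y by (auto simp: ultra_summit_set_def)
    then have "(?c ^^ m) y \<in> (\<lambda>n. (?c ^^ n) y) ` {..<n}" for m
      by (intro image_eqI[of _ _ "m mod n"]) (simp_all add: funpow_mod_eq)
    then have "range (\<lambda>n. (?c ^^ n) y) \<subseteq> (\<lambda>n. (?c ^^ n) y) ` {..<n}"
      by (rule image_subsetI)
    then have "finite (range (\<lambda>n. (?c ^^ n) y))"
      by (rule finite_subset) simp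
    then have "finite (range (\<lambda>n. (?c ^^ n) y) \<times> {u \<in> M. u \<preceq> \<delta> [^] k} \<times> {v \<in> M. v \<preceq> \<delta> [^] l})"
      by (intro finite_cartesian_product finite_below_delta_pow)
    then show ?thesis by (rule rev_finite_subset) (auto simp: A_def)
  qed
  moreover have "?F ` A \<subseteq> A"
  proof clarify
    fix z u v assume zuv: "(z, u, v) \<in> A"
    then obtain m where "z = (?c ^^ m) y" by (auto simp: A_def)
    then have "?c z = (?c ^^ Suc m) y" by simp
    then have "?c z \<in> range (\<lambda>n. (?c ^^ n) y)" by (rule range_eqI)
    with zuv transport_below_delta_pow[of z u k] transport_below_delta_pow[of z v l]
    show "(?c z, transport z u, transport z v) \<in> A"
      by (simp add: A_def conj cycling_ultra_summit_set x carrier)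
  qed
  moreover have "inj_on ?F A"
  proof (rule inj_onI)
    fix p q assume pq: "p \<in> A" "q \<in> A" "?F p = ?F q"
    obtain z u v z' u' v' where p: "p = (z, u, v)" "q = (z', u', v')"
      by (metis prod_cases3)
    note A = pq(1,2)[unfolded p]
    have eq: "?c z = ?c z'" "transport z u = transport z' u'" "transport z v = transport z' v'"
      using pq(3) by (simp_all add: p)
    \<comment> \<open>The base point is recovered first, by injectivity of cycling;
      \<open>transport_inj\<close> then applies to each conjugator at this common base
      point.\<close>
    have "z = z'"
      using inj_onD[OF inj_on_cycling[of x] eq(1)] A by (simp add: A_def)
    then show "p = q"
      using A eq x unfolding p by (auto simp: A_def intro: transport_inj)
  qed
  moreover have "(y, s, t) \<in> A"
    using y s t kl by (auto simp: A_def intro: range_eqI[of _ _ 0])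
  ultimately obtain n where n: "n > 0" "(?F ^^ n) (y, s, t) = (y, s, t)"
    using inj_on_finite_periodic by meson
  have "(?F ^^ n) (z, u, v) = ((?c ^^ n) z, transports n z u, transports n z v)" for n z u v
    by (induction n arbitrary: z u v) (simp_all add: funpow_Suc_right del: funpow.simps(2))
  then have fixed: "(?c ^^ n) y = y" "transports n y s = s" "transports n y t = t"
    using n(2) by simp_all
  have S: "conj_by G y (s \<curlywedge> t) \<in> super_summit_set G M \<delta> x"
    using x y s t by (intro conj_by_meet_super_summit_set) (simp_all add: ultra_summit_setD)
  have "(?c ^^ n) (conj_by G y (s \<curlywedge> t)) = conj_by G y (s \<curlywedge> t)"
    using conj_by_transports[OF x ultra_summit_setD[OF y] _ S, of n] fixed s(1) t(1) carrier[OF y]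
    by (simp add: transports_meet)
  with S n(1) show ?thesis by (auto simp: ultra_summit_set_def)
qed

text \<open>Shift \<open>g\<close> into \<open>M\<close> by a power of \<delta>. Conjugation by
  \<delta> is injective on the finite interval below some \<delta>^l containing the result, so a
  positive power of \<delta> commutes with the shifted element, hence with \<open>g\<close>.\<close>

lemma ex_delta_pow_commute:
  assumes "g \<in> carrier G"
  shows "\<exists>n>0. \<delta> [^] (n::nat) \<otimes> g = g \<otimes> \<delta> [^] n"
proof -
  let ?f = "\<lambda>a. inv \<delta> \<otimes> a \<otimes> \<delta>"
  obtain k :: nat where m: "\<delta> [^] k \<otimes> g \<in> M" (is "?m \<in> M")
    using delta_pow_mult_cone assms by blast
  then obtain l :: nat where l: "?m \<preceq> \<delta> [^] l"
    using ex_le_delta_pow cone_carrier by blast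
  let ?A = "{s \<in> M. s \<preceq> \<delta> [^] l}"
  have comm: "\<delta> [^] l \<otimes> \<delta> = \<delta> \<otimes> \<delta> [^] l"
    by (simp flip: nat_pow_Suc2)
  have "?f a \<preceq> \<delta> [^] l" if "a \<in> M" "a \<preceq> \<delta> [^] l" for a
  proof -
    have "inv \<delta> \<otimes> (a \<otimes> \<delta>) \<preceq> inv \<delta> \<otimes> (\<delta> [^] l \<otimes> \<delta>)"
      using that by simp
    then show ?thesis
      using that by (simp add: m_assoc comm inv_mult_cancel)
  qed
  then have "?f ` ?A \<subseteq> ?A" using conj_delta_cone by auto
  moreover have "inj_on ?f ?A" by (rule inj_onI) simp
  ultimately obtain n where n: "n > 0" "(?f ^^ n) ?m = ?m"
    using inj_on_finite_periodic[of ?A ?f ?m] finite_below_delta_pow m l by blast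
  have "(?f ^^ n) ?m = inv (\<delta> [^] n) \<otimes> ?m \<otimes> \<delta> [^] n" for n
    using m by (induction n) (simp_all add: m_assoc inv_mult_group)
  then have "?m = inv (\<delta> [^] n) \<otimes> (?m \<otimes> \<delta> [^] n)"
    using n m by (simp add: m_assoc)
  then have "\<delta> [^] n \<otimes> (\<delta> [^] k \<otimes> g) = \<delta> [^] k \<otimes> (g \<otimes> \<delta> [^] n)"
    using m assms by (metis inv_mult_cancel(2) m_assoc cone_carrier delta_carrier nat_pow_closed m_closed)
  moreover have "\<delta> [^] n \<otimes> (\<delta> [^] k \<otimes> g) = \<delta> [^] k \<otimes> (\<delta> [^] n \<otimes> g)"
    using assms by (simp add: nat_pow_mult add.commute flip: m_assoc)
  ultimately have "\<delta> [^] n \<otimes> g = g \<otimes> \<delta> [^] n"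
    using assms by simp
  with n(1) show ?thesis by blast
qed

section \<open>Counting positive divisors, and descent along minimal conjugators\<close>

abbreviation below :: "'a \<Rightarrow> 'a set"
  where "below c \<equiv> {s \<in> M. s \<preceq> c}"

lemma finite_below:
  assumes "c \<in> carrier G"
  shows "finite (below c)"
proof -
  obtain n :: nat where "c \<preceq> \<delta> [^] n" using ex_le_delta_pow assms by blast
  then have "below c \<subseteq> below (\<delta> [^] n)"
    using le_trans[of _ c "\<delta> [^] n"] assms by auto
  then show ?thesis using finite_below_delta_pow finite_subset by blast
qed

lemma card_below_less:
  assumes "a \<preceq> b" "a \<noteq> b" "a \<in> M" "b \<in> M"
  shows "card (below a) < card (below b)"
proof (rule psubset_card_mono)
  have "b \<notin> below a" using le_antisym[of a b] assms by auto
  moreover have "below a \<subseteq> below b" using le_trans[of _ a b] assms by auto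
  ultimately show "below a \<subset> below b" using assms(4) by auto
qed (use assms finite_below in simp)

text \<open>Left multiplication by \<open>a\<close> embeds the divisors of \<open>m\<close> into
  those of a m and misses \<open>\<one>\<close>, because \<open>a\<close> is not invertible in
  \<open>M\<close>.\<close>

lemma card_below_quotient:
  assumes a: "a \<in> M" "a \<noteq> \<one>" and m: "m \<in> M"
  shows "card (below m) < card (below (a \<otimes> m))"
proof -
  have "inj_on ((\<otimes>) a) (below m)"
    using a(1) by (intro inj_onI) simp
  then have "card (below m) = card ((\<otimes>) a ` below m)"
    by (simp add: card_image)
  also have "\<dots> < card (below (a \<otimes> m))"
  proof (rule psubset_card_mono)
    have "\<one> \<notin> (\<otimes>) a ` below m"
    proof clarify
      fix s assume s: "s \<in> M" "\<one> = a \<otimes> s"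
      then have "inv a = s" using a(1) by (metis cone_carrier inv_mult_cancel(1) inv_closed r_one)
      then show False using s(1) a cone_pointed by blast
    qed
    moreover have "\<one> \<in> below (a \<otimes> m)"
      using a m by (simp add: one_cone one_le_iff mult_cone)
    moreover have "(\<otimes>) a ` below m \<subseteq> below (a \<otimes> m)"
      using a m by (auto simp: mult_cone)
    ultimately show "(\<otimes>) a ` below m \<subset> below (a \<otimes> m)" by blast
  qed (use a m finite_below in simp)
  finally show ?thesis .
qed

text \<open>If the gcd were \<open>\<one>\<close>, \<open>quotient_le_delta_pow\<close> would lower
  the exponent of any bound \<delta>^n of \<open>c\<close> down to 0, forcing \<open>c\<close> to be
  \<open>\<one>\<close>.\<close>

lemma meet_delta_not_one:
  assumes "c \<in> M" "c \<noteq> \<one>"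
  shows "c \<curlywedge> \<delta> \<noteq> \<one>"
proof
  assume meet: "c \<curlywedge> \<delta> = \<one>"
  have "\<not> c \<preceq> \<delta> [^] n" for n :: nat
  proof (induction n)
    case 0
    then show ?case using assms le_antisym[of c \<one>] by (auto simp: one_le_iff)
  next
    case (Suc n)
    then show ?case using quotient_le_delta_pow[OF assms(1), of n] meet assms by auto
  qed
  then show False using ex_le_delta_pow assms(1) cone_carrier by blast
qed

lemma ex_minimal_uss_conjugator:
  assumes "u \<in> uss_conjugators G M \<delta> x y"
  shows "\<exists>c\<in>minimal_uss_conjugators G M \<delta> x y. c \<preceq> u"
proof -
  let ?P = "\<lambda>c. c \<in> uss_conjugators G M \<delta> x y \<and> c \<preceq> u"
  have M: "c \<in> M" if "c \<in> uss_conjugators G M \<delta> x y" for c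
    using that by (auto simp: uss_conjugators_def simple_elements_eq)
  have "?P u" using assms M by simp
  \<comment> \<open>Among the conjugators below \<open>u\<close>, one with the fewest positive
    divisors is minimal by \<open>card_below_less\<close>.\<close>
  then obtain c where c: "?P c" and min: "\<And>b. ?P b \<Longrightarrow> card (below c) \<le> card (below b)"
    using ex_has_least_nat[of ?P u "\<lambda>c. card (below c)"] by blast
  have "b = c" if b: "b \<in> uss_conjugators G M \<delta> x y" "b \<preceq> c" for b
  proof (rule ccontr)
    assume "b \<noteq> c"
    then have "card (below b) < card (below c)"
      using b c M by (intro card_below_less) auto
    moreover have "b \<preceq> u"
      using b(2) c M[OF b(1)] M[of c] M[OF assms] by (auto intro: le_trans)
    ultimately show False using min b(1) by fastforce
  qed
  then show ?thesis using c by (auto simp: minimal_uss_conjugators_def)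
qed

lemma positive_conj_by_closed:
  assumes x: "x \<in> carrier G" and U: "U \<subseteq> ultra_summit_set G M \<delta> x"
    and closed: "\<And>y c. \<lbrakk>y \<in> U; c \<in> minimal_uss_conjugators G M \<delta> x y\<rbrakk> \<Longrightarrow> conj_by G y c \<in> U"
    and "y \<in> U" "c \<in> M" "conj_by G y c \<in> ultra_summit_set G M \<delta> x"
  shows "conj_by G y c \<in> U"
  using assms(4-)
proof (induction "card (below c)" arbitrary: y c rule: less_induct)
  case less
  have y: "y \<in> ultra_summit_set G M \<delta> x" using less.prems(1) U by blast
  then have yc: "y \<in> carrier G" using ultra_summit_set_carrier x by blast
  show ?case
  proof (cases "c = \<one>")
    case True
    then show ?thesis using less.prems(1) yc by simp
  next
    case False
    let ?u = "c \<curlywedge> \<delta>"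
    \<comment> \<open>Both \<open>c\<close> and \<delta> conjugate \<open>y\<close> into the ultra
      summit set, hence so does their gcd, which is simple and nontrivial.\<close>
    have "?u \<in> uss_conjugators G M \<delta> x y"
      using less.prems x y False
      by (simp add: uss_conjugators_def simple_elements_eq meet_cone delta_cone meet_delta_not_one
          conj_by_meet_ultra_summit_set conj_by_delta_ultra_summit_set)
    then obtain v where v: "v \<in> minimal_uss_conjugators G M \<delta> x y" "v \<preceq> ?u"
      using ex_minimal_uss_conjugator by blast
    then have vM: "v \<in> M" "v \<noteq> \<one>"
      by (auto simp: minimal_uss_conjugators_def uss_conjugators_def simple_elements_eq)
    \<comment> \<open>The minimal \<open>v\<close>, rather than \<open>?u\<close>, is divided off,
      since closure of \<open>U\<close> is assumed for minimal conjugators. The induction continues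
      from the conjugate of \<open>y\<close> by \<open>v\<close>.\<close>
    let ?d = "inv v \<otimes> c"
    have "v \<preceq> c" using v(2) vM(1) less.prems(2) by simp
    then have d: "?d \<in> M" by (simp add: le_iff)
    have c_eq: "c = v \<otimes> ?d" using vM(1) less.prems(2) by (simp add: inv_mult_cancel)
    have "card (below ?d) < card (below c)"
      using card_below_quotient[OF vM d] c_eq by simp
    moreover have "conj_by G y v \<in> U" using closed less.prems(1) v(1) by blast
    moreover have conj: "conj_by G (conj_by G y v) ?d = conj_by G y c"
      using yc vM(1) d c_eq by (simp add: conj_by_mult)
    ultimately show ?thesis
      using less.hyps[of ?d "conj_by G y v"] d less.prems(3) by simp
  qed
qed

lemma closed_subset_eq_ultra_summit_set:
  assumes x: "x \<in> carrier G" and U: "U \<subseteq> ultra_summit_set G M \<delta> x" "U \<noteq> {}"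
    and closed: "\<And>y c. \<lbrakk>y \<in> U; c \<in> minimal_uss_conjugators G M \<delta> x y\<rbrakk> \<Longrightarrow> conj_by G y c \<in> U"
  shows "U = ultra_summit_set G M \<delta> x"
proof (rule equalityI[OF U(1)], rule subsetI)
  fix z assume z: "z \<in> ultra_summit_set G M \<delta> x"
  obtain y where y: "y \<in> U" using U(2) by blast
  obtain a b where ab: "a \<in> carrier G" "y = conj_by G x a" "b \<in> carrier G" "z = conj_by G x b"
    using y z U(1) by (auto simp: ultra_summit_set_def super_summit_set_def conjugates_def)
  let ?c = "inv a \<otimes> b"
  have c: "?c \<in> carrier G" "z = conj_by G y ?c" and yc: "y \<in> carrier G"
    using ab x by (simp_all add: conj_by_mult inv_mult_cancel)
  obtain n where n: "n > 0" "\<delta> [^] n \<otimes> y = y \<otimes> \<delta> [^] (n::nat)"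
    using ex_delta_pow_commute yc by blast
  obtain k where k: "\<delta> [^] (k::nat) \<otimes> ?c \<in> M"
    using delta_pow_mult_cone c(1) by blast
  \<comment> \<open>The exponent is a multiple of \<open>n\<close>, so \<open>?e\<close> commutes
    with \<open>y\<close>, and at least \<open>k\<close>, so \<open>?e\<close> makes the conjugator
    positive.\<close>
  let ?e = "\<delta> [^] (n * k)"
  have "?e = \<delta> [^] (n * k - k) \<otimes> \<delta> [^] k"
    using n(1) by (simp add: nat_pow_mult)
  then have "?e \<otimes> ?c \<in> M"
    using mult_cone[OF delta_pow_cone k, of "n * k - k"] c(1) by (simp add: m_assoc)
  moreover have "?e \<otimes> y = y \<otimes> ?e"
    using group_commutes_pow[OF n(2), of k] yc by (simp add: nat_pow_pow)
  then have "conj_by G y ?e = y"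
    using yc by (simp add: conj_by_def m_assoc inv_mult_cancel flip: \<open>?e \<otimes> y = y \<otimes> ?e\<close>)
  then have "conj_by G y (?e \<otimes> ?c) = z"
    using c yc conj_by_mult[of y ?e ?c] by simp
  ultimately show "z \<in> U"
    using positive_conj_by_closed[OF x U(1) closed y] z by metis
qed

end

section \<open>The positive cone of a Garside group\<close>

lemma (in monoid) list_prod_closed: "set as \<subseteq> carrier G \<Longrightarrow> list_prod G as \<in> carrier G"
  by (induction as) simp_all

lemma (in monoid) list_prod_append:
  "\<lbrakk>set as \<subseteq> carrier G; set bs \<subseteq> carrier G\<rbrakk> \<Longrightarrow>
    list_prod G (as @ bs) = list_prod G as \<otimes> list_prod G bs"
  using list_prod_closed[of bs]
  by (induction as) (simp_all add: m_assoc list_prod_closed)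

text \<open>Concatenating atom words for \<open>a\<close> and \<open>b\<close> gives a word for
  \<open>\<one>\<close>, and so do all its repetitions. The bound on word lengths forces the word to
  be empty.\<close>

lemma atomic_monoid_unit:
  fixes M (structure)
  assumes "monoid M" "atomic_monoid M" "a \<in> carrier M" "b \<in> carrier M" "a \<otimes> b = \<one>"
  shows "a = \<one>"
proof -
  interpret monoid M by fact
  have gen: "\<exists>as. set as \<subseteq> atoms M \<and> list_prod M as = c" if "c \<in> carrier M" for c
    using assms(2) that by (auto simp: atomic_monoid_def generates_monoid_def)
  obtain as bs where as: "set as \<subseteq> atoms M" "list_prod M as = a"
    and bs: "set bs \<subseteq> atoms M" "list_prod M bs = b"
    using gen[OF assms(3)] gen[OF assms(4)] by blast
  obtain N :: nat where N: "\<And>cs. \<lbrakk>set cs \<subseteq> atoms M; list_prod M cs = \<one>\<rbrakk> \<Longrightarrow> length cs \<le> N"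
    using assms(2) one_closed unfolding atomic_monoid_def by blast
  let ?power = "\<lambda>n. concat (replicate n (as @ bs))"
  have atoms: "atoms M \<subseteq> carrier M" by (auto simp: atoms_def)
  have set_power: "set (?power n) \<subseteq> atoms M" for n
    using as(1) bs(1) by (induction n) auto
  have "list_prod M (?power n) = \<one>" for n
  proof (induction n)
    case 0
    show ?case by simp
  next
    case (Suc n)
    have "set as \<subseteq> carrier M" "set bs \<subseteq> carrier M" "set (?power n) \<subseteq> carrier M"
      using as(1) bs(1) set_power atoms by blast+
    then have "list_prod M (as @ bs @ ?power n) = a \<otimes> (b \<otimes> \<one>)"
      using Suc as(2) bs(2) by (simp add: list_prod_append)
    then show ?case using assms(4,5) by simp
  qed
  from N[OF set_power this] have "length (?power (Suc N)) \<le> N" .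
  moreover have "length (?power n) = n * length (as @ bs)" for n
    by (induction n) simp_all
  ultimately have "Suc N * length (as @ bs) \<le> N" by metis
  then have "as = []"
    by (cases "length (as @ bs)") auto
  then show ?thesis using as(2) by simp
qed

lemma
  fixes G (structure)
  assumes "garside_group G M \<delta>"
  shows garside_group_group: "group G"
    and garside_group_subset: "M \<subseteq> carrier G"
    and garside_group_fraction: "g \<in> carrier G \<Longrightarrow> \<exists>a\<in>M. \<exists>b\<in>M. g = a \<otimes> inv b"
    and garside_group_monoid: "garside_monoid (G\<lparr>carrier := M\<rparr>) \<delta>"
  using assms by (auto simp: garside_group_def garside_group_axioms_def)

lemma
  fixes G (structure)
  assumes "garside_group G M \<delta>"
  shows garside_group_one: "\<one> \<in> M"
    and garside_group_mult: "\<lbrakk>a \<in> M; b \<in> M\<rbrakk> \<Longrightarrow> a \<otimes> b \<in> M"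
    and garside_group_pointed: "\<lbrakk>a \<in> M; inv a \<in> M\<rbrakk> \<Longrightarrow> a = \<one>"
proof -
  interpret group G using garside_group_group assms .
  have mon: "monoid (G\<lparr>carrier := M\<rparr>)" and atomic: "atomic_monoid (G\<lparr>carrier := M\<rparr>)"
    using garside_group_monoid[OF assms]
    by (simp_all add: garside_monoid_def monoid_cancel_def garside_monoid_axioms_def)
  show "\<one> \<in> M" using monoid.one_closed[OF mon] by simp
  show "a \<otimes> b \<in> M" if "a \<in> M" "b \<in> M" using monoid.m_closed[OF mon] that by simp
  show "a = \<one>" if "a \<in> M" "inv a \<in> M"
    using atomic_monoid_unit[OF mon atomic, of a "inv a"] that garside_group_subset[OF assms]
    by (simp add: subsetD)
qed

text \<open>Divisibility inside \<open>M\<close> becomes membership in \<open>M\<close> of a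
  quotient formed in \<open>G\<close>. The second claim is the equality of the left and right
  divisors of \<delta>.\<close>

lemma
  fixes G (structure)
  assumes "garside_group G M \<delta>"
  shows garside_group_delta: "\<delta> \<in> M"
    and garside_group_right_simple_iff: "a \<in> M \<Longrightarrow> \<delta> \<otimes> inv a \<in> M \<longleftrightarrow> inv a \<otimes> \<delta> \<in> M"
    and garside_group_finite_simples: "finite {s \<in> M. inv s \<otimes> \<delta> \<in> M}"
    and garside_group_generated:
      "a \<in> M \<Longrightarrow> \<exists>as. set as \<subseteq> {s \<in> M. inv s \<otimes> \<delta> \<in> M} \<and> list_prod G as = a"
    and garside_group_gcd: "\<lbrakk>a \<in> M; b \<in> M\<rbrakk> \<Longrightarrow> \<exists>d\<in>M. inv d \<otimes> a \<in> M \<and> inv d \<otimes> b \<in> M \<and>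
      (\<forall>e\<in>M. inv e \<otimes> a \<in> M \<and> inv e \<otimes> b \<in> M \<longrightarrow> inv e \<otimes> d \<in> M)"
proof -
  interpret group G using garside_group_group assms .
  let ?M = "G\<lparr>carrier := M\<rparr>"
  have element: "garside_element ?M \<delta>"
    and gcd: "\<And>a b. \<lbrakk>a \<in> M; b \<in> M\<rbrakk> \<Longrightarrow> \<exists>d\<in>M. d gcdof\<^bsub>?M\<^esub> a b"
    using garside_group_monoid[OF assms]
    by (simp_all add: garside_monoid_def garside_monoid_axioms_def)
  have carrier: "a \<in> carrier G" if "a \<in> M" for a
    using garside_group_subset[OF assms] that by blast
  have divides: "a divides\<^bsub>?M\<^esub> b \<longleftrightarrow> inv a \<otimes> b \<in> M" if "a \<in> M" "b \<in> M" for a b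
    using that carrier inv_mult_cancel[of a] by (force simp: factor_def)
  have right_divides: "right_divides ?M a b \<longleftrightarrow> b \<otimes> inv a \<in> M" if "a \<in> M" "b \<in> M" for a b
  proof
    assume "right_divides ?M a b"
    then obtain c where "c \<in> M" "b = c \<otimes> a" by (auto simp: right_divides_def)
    then show "b \<otimes> inv a \<in> M" using that carrier by (simp add: m_assoc)
  next
    assume "b \<otimes> inv a \<in> M"
    then show "right_divides ?M a b"
      using that carrier by (auto simp: right_divides_def m_assoc intro!: bexI[of _ "b \<otimes> inv a"])
  qed
  show \<delta>: "\<delta> \<in> M" using element by (simp add: garside_element_def)
  \<comment> \<open>Unfolding and refolding \<open>list_prod\<close> replaces products in the
    restricted structure by the same products in \<open>G\<close>.\<close>
  note unfolded = element[unfolded garside_element_def generates_monoid_def list_prod_def, simplified,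
      folded list_prod_def]
  have finite: "finite {s \<in> M. s divides\<^bsub>?M\<^esub> \<delta>}"
    and generated: "\<forall>a\<in>M. \<exists>as. set as \<subseteq> {s \<in> M. s divides\<^bsub>?M\<^esub> \<delta>} \<and> list_prod G as = a"
    and balanced: "{s \<in> M. s divides\<^bsub>?M\<^esub> \<delta>} = {s \<in> M. right_divides ?M s \<delta>}"
    using unfolded by blast+
  have simples: "{s \<in> M. s divides\<^bsub>?M\<^esub> \<delta>} = {s \<in> M. inv s \<otimes> \<delta> \<in> M}"
    using divides \<delta> by blast
  have "{s \<in> M. inv s \<otimes> \<delta> \<in> M} = {s \<in> M. right_divides ?M s \<delta>}"
    unfolding simples[symmetric] by (rule balanced)
  also have "\<dots> = {s \<in> M. \<delta> \<otimes> inv s \<in> M}"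
    using right_divides \<delta> by blast
  finally show "\<delta> \<otimes> inv a \<in> M \<longleftrightarrow> inv a \<otimes> \<delta> \<in> M" if "a \<in> M"
    using that by blast
  show "finite {s \<in> M. inv s \<otimes> \<delta> \<in> M}"
    unfolding simples[symmetric] by (rule finite)
  show "\<exists>as. set as \<subseteq> {s \<in> M. inv s \<otimes> \<delta> \<in> M} \<and> list_prod G as = a" if "a \<in> M"
    unfolding simples[symmetric] using that by (rule generated[rule_format])
  show "\<exists>d\<in>M. inv d \<otimes> a \<in> M \<and> inv d \<otimes> b \<in> M \<and>
      (\<forall>e\<in>M. inv e \<otimes> a \<in> M \<and> inv e \<otimes> b \<in> M \<longrightarrow> inv e \<otimes> d \<in> M)" if "a \<in> M" "b \<in> M"
    using gcd[OF that] that by (auto simp: isgcd_def divides)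
qed

lemma garside_group_induct [consumes 2, case_names one mult]:
  fixes G (structure)
  assumes "garside_group G M \<delta>" "a \<in> M"
    and one: "P \<one>"
    and mult: "\<And>s m. \<lbrakk>s \<in> M; inv s \<otimes> \<delta> \<in> M; m \<in> M; P m\<rbrakk> \<Longrightarrow> P (s \<otimes> m)"
  shows "P a"
proof -
  obtain as where as: "set as \<subseteq> {s \<in> M. inv s \<otimes> \<delta> \<in> M}" "list_prod G as = a"
    using garside_group_generated[OF assms(1,2)] by blast
  from as(1) have "list_prod G as \<in> M \<and> P (list_prod G as)"
  proof (induction as)
    case Nil
    then show ?case using one garside_group_one[OF assms(1)] by simp
  next
    case (Cons s as)
    then show ?case
      using mult garside_group_mult[OF assms(1)] by simp
  qed
  then show ?thesis using as(2) by simp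
qed

lemma garside_cone_of_garside_group:
  fixes G (structure)
  assumes garside: "garside_group G M \<delta>" and not_one: "\<delta> \<noteq> \<one>"
  shows "garside_cone G M \<delta>"
proof -
  interpret group G using garside_group_group garside .
  note mult_M = garside_group_mult[OF garside] and \<delta> = garside_group_delta[OF garside]
    and right_simple_iff = garside_group_right_simple_iff[OF garside]
  have carrier [simp]: "a \<in> carrier G" if "a \<in> M" for a
    using garside_group_subset[OF garside] that by blast
  have \<delta>_carrier [simp]: "\<delta> \<in> carrier G" using \<delta> by simp
  have conj: "inv \<delta> \<otimes> a \<otimes> \<delta> \<in> M" if "a \<in> M" for a
    using garside that
  proof (induction a rule: garside_group_induct)
    case (mult s m)
    \<comment> \<open>Let \<open>d\<close> be the complement of \<open>s\<close>, with s d =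
      \<delta>. It is a right divisor of \<delta>, hence a left divisor, and its own complement is
      the conjugate of \<open>s\<close> by \<delta>.\<close>
    have "\<delta> \<otimes> inv (inv s \<otimes> \<delta>) = s"
      using mult(1) by (simp add: inv_mult_group inv_mult_cancel)
    then have "inv (inv s \<otimes> \<delta>) \<otimes> \<delta> \<in> M"
      using right_simple_iff[OF mult(2)] mult(1) by simp
    then show ?case
      using mult_M[OF _ mult(4), of "inv \<delta> \<otimes> s \<otimes> \<delta>"] mult
      by (simp add: inv_mult_group m_assoc inv_mult_cancel)
  qed (simp add: garside_group_one[OF garside])
  have conj_inv: "\<delta> \<otimes> a \<otimes> inv \<delta> \<in> M" if "a \<in> M" for a
    using garside that
  proof (induction a rule: garside_group_induct)
    case (mult s m)
    have d: "\<delta> \<otimes> inv s \<in> M" using right_simple_iff mult by blast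
    \<comment> \<open>The mirror image: now d s = \<delta>, and the left cofactor of
      \<open>d\<close> in \<delta> is the conjugate of \<open>s\<close> by the inverse of
      \<delta>.\<close>
    have "inv (\<delta> \<otimes> inv s) \<otimes> \<delta> = s"
      using mult(1) by (simp add: inv_mult_group m_assoc)
    then have "\<delta> \<otimes> inv (\<delta> \<otimes> inv s) \<in> M"
      using right_simple_iff[OF d] mult(1) by simp
    then show ?case
      using mult_M[OF _ mult(4), of "\<delta> \<otimes> s \<otimes> inv \<delta>"] mult
      by (simp add: inv_mult_group m_assoc inv_mult_cancel)
  qed (simp add: garside_group_one[OF garside])
  have denominator: "\<exists>n::nat. \<delta> [^] n \<otimes> inv b \<in> M" if "b \<in> M" for b
    using garside that
  proof (induction b rule: garside_group_induct)
    case one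
    show ?case using garside_group_one[OF garside] by (intro exI[of _ 0]) simp
  next
    case (mult s m)
    then obtain n :: nat where n: "\<delta> [^] n \<otimes> inv m \<in> M" by blast
    have "\<delta> \<otimes> inv s \<in> M" using right_simple_iff mult by blast
    \<comment> \<open>One more factor \<delta> absorbs \<open>s\<close>: moving it past the positive
      element given by induction only conjugates that element.\<close>
    from mult_M[OF conj_inv[OF n] this] have "\<delta> [^] Suc n \<otimes> inv (s \<otimes> m) \<in> M"
      using mult unfolding nat_pow_Suc2[OF \<delta>_carrier]
      by (simp add: inv_mult_group m_assoc inv_mult_cancel)
    then show ?case by blast
  qed
  have conj_inv_pow: "\<delta> [^] n \<otimes> a \<otimes> inv (\<delta> [^] n) \<in> M" if "a \<in> M" for a and n :: nat
  proof (induction n)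
    case (Suc n)
    from conj_inv[OF this] show ?case
      using that unfolding nat_pow_Suc2[OF \<delta>_carrier] by (simp add: inv_mult_group m_assoc)
  qed (use that in simp)
  show ?thesis
  proof
    fix g assume "g \<in> carrier G"
    then obtain a b where ab: "a \<in> M" "b \<in> M" "g = a \<otimes> inv b"
      using garside_group_fraction[OF garside] by blast
    obtain n :: nat where n: "\<delta> [^] n \<otimes> inv b \<in> M" using denominator ab(2) by blast
    \<comment> \<open>The power that clears the denominator passes the numerator \<open>a\<close> at
      the cost of a conjugation, which keeps it positive.\<close>
    from mult_M[OF conj_inv_pow[OF ab(1), of n] n] show "\<exists>n::nat. \<delta> [^] n \<otimes> g \<in> M"
      using ab by (auto simp: m_assoc inv_mult_cancel)
  qed (use garside not_one mult_M \<delta> conj conj_inv in \<open>simp_all add: garside_group_subset garside_group_one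
      garside_group_pointed garside_group_finite_simples garside_group_gcd\<close>)
qed

text \<open>When \<delta> is \<open>\<one>\<close>, every simple element has its inverse in
  \<open>M\<close> and is \<open>\<one>\<close>; the simple elements generate \<open>M\<close>. This
  settles the case in which infimum and supremum are unspecified.\<close>

lemma garside_group_trivial:
  fixes G (structure)
  assumes garside: "garside_group G M \<delta>" and "\<delta> = \<one>"
  shows "carrier G = {\<one>}"
proof -
  interpret group G using garside_group_group garside .
  have M: "a = \<one>" if "a \<in> M" for a
    using garside that
  proof (induction a rule: garside_group_induct)
    case (mult s m)
    have "s \<in> carrier G" using garside_group_subset[OF garside] mult(1) by (rule subsetD)
    then have "inv s \<in> M" using mult(2) \<open>\<delta> = \<one>\<close> by simp
    with mult(1) have "s = \<one>" by (rule garside_group_pointed[OF garside])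
    then show ?case using mult(4) by simp
  qed simp
  have "g = \<one>" if g: "g \<in> carrier G" for g
  proof -
    obtain a b where ab: "a \<in> M" "b \<in> M" "g = a \<otimes> inv b"
      using garside_group_fraction[OF garside g] by blast
    show ?thesis unfolding ab(3) M[OF ab(1)] M[OF ab(2)] by simp
  qed
  then show ?thesis using one_closed by blast
qed

theorem corollary1p20:
  fixes G :: "('a, 'b) monoid_scheme" (structure) and M U :: "'a set" and \<delta> x :: 'a
  assumes "garside_group G M \<delta>"
    and "x \<in> carrier G"
    and "U \<subseteq> ultra_summit_set G M \<delta> x"
    and "U \<noteq> {}"
    and "{conj_by G y c | y c. y \<in> U \<and> c \<in> minimal_uss_conjugators G M \<delta> x y} \<subseteq> U"
  shows "U = ultra_summit_set G M \<delta> x"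
proof (cases "\<delta> = \<one>")
  case True
  interpret group G using garside_group_group assms(1) .
  \<comment> \<open>The ultra summit set has at most one element here, whatever the unspecified
    extrema are, so a nonempty subset is all of it.\<close>
  have "ultra_summit_set G M \<delta> x \<subseteq> carrier G"
    using assms(2)
    by (auto simp: ultra_summit_set_def super_summit_set_def conjugates_def)
  then have "ultra_summit_set G M \<delta> x \<subseteq> {\<one>}"
    unfolding garside_group_trivial[OF assms(1) True] .
  then show ?thesis
    using assms(3,4) by (metis subset_empty subset_singletonD)
next
  case False
  interpret garside_cone G M \<delta>
    using garside_cone_of_garside_group assms(1) False .
  have "conj_by G y c \<in> U" if "y \<in> U" "c \<in> minimal_uss_conjugators G M \<delta> x y" for y c
    using that by (intro subsetD[OF assms(5), OF CollectI]) metis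
  then show ?thesis by (rule closed_subset_eq_ultra_summit_set[OF assms(2-4)])
qed

end
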